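(* Let $\mathfrak g$ be a metric Lie algebra with $Ann_R(\mathfrak g)=Ann(\mathfrak g)$, and let $$\mathfrak g=\mathfrak g_0\oplus\bigoplus_{i=1}^n\mathfrak g_i=\mathfrak g'_0\oplus\bigoplus_{j=1}^m\mathfrak g'_j$$ be two orthogonal direct sum decompositions such that $\mathfrak g_0$ and $\mathfrak g'_0$ are maximal non-degenerate subspaces of $Ann(\mathfrak g)$ (possibly zero), and each $\mathfrak g_i$ and $\mathfrak g'_j$ with $i,j\geq1$ is a non-zero, indecomposable, non-degenerate strong ideal of $\mathfrak g$ with totally isotropic right annihilator. Then $n=m$. After reordering the factors $\mathfrak g'_1,\dots,\mathfrak g'_m$, for all $1\le i,j\le n$, $$\nabla_{\mathfrak g_i}\mathfrak g_i=\nabla_{\mathfrak g_i}\mathfrak g'_i=\nabla_{\mathfrak g'_i}\mathfrak g_i=\nabla_{\mathfrak g'_i}\mathfrak g'_i,\qquad \nabla_{\mathfrak g_i}\mathfrak g'_j=\nabla_{\mathfrak g'_j}\mathfrak g_i=0\quad(i\ne j).$$ Moreover, there exist strong isometries $\phi_i:\mathfrak g_i\to\mathfrak g'_i$, $0\le i\le n$, whose direct sum is a strong isometry of $\mathfrak g$ onto itself, and for $i\geq1$ the map $\phi_i$ can be chosen to be the identity on $D_i=\nabla_{\mathfrak g_i}\mathfrak g_i$.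
   Context: A metric Lie algebra is a finite-dimensional real Lie algebra $\mathfrak g$ with a non-degenerate symmetric bilinear form $\langle\cdot,\cdot\rangle$ (of arbitrary signature). Its Levi-Civita product $\nabla_XY$ is the bilinear product determined by $2\langle\nabla_XY,Z\rangle=\langle[X,Y],Z\rangle-\langle[Y,Z],X\rangle+\langle[Z,X],Y\rangle$. For subspaces, $\nabla_{\mathfrak a}\mathfrak b$ is the linear span of all $\nabla_XY$ with $X\in\mathfrak a$, $Y\in\mathfrak b$. The right annihilator is $Ann_R(\mathfrak g)=\{X\in\mathfrak g:\nabla_YX=0\ \forall Y\in\mathfrak g\}$, and $Ann(\mathfrak g)=\{X\in\mathfrak g:\nabla_YX=\nabla_XY=0\ \forall Y\in\mathfrak g\}$. A subspace is totally isotropic if $\langle X,Y\rangle=0$ for all $X,Y$ in it, and non-degenerate if $\langle\cdot,\cdot\rangle$ restricts to a non-degenerate form on it. A subspace $\mathfrak h$ is a strong ideal if $\nabla_{\mathfrak g}\mathfrak h\subseteq\mathfrak h$ and $\nabla_{\mathfrak h}\mathfrak g\subseteq\mathfrak h$. A metric Lie algebra is decomposable if it is a direct sum of two non-zero, non-degenerate strong ideals, and indecomposable otherwise; a non-degenerate strong ideal is itself regarded as a metric Lie algebra with the restricted bracket and form. Orthogonal means distinct summands are orthogonal for $\langle\cdot,\cdot\rangle$. A strong isometry is a linear bijection $\pi$ between metric Lie algebras with $\pi(\nabla_XY)=\nabla'_{\pi(X)}\pi(Y)$ and $\langle\pi(X),\pi(Y)\rangle'=\langle X,Y\rangle$. 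*)

theory Defs
  imports "HOL-Analysis.Analysis" "HOL-Combinatorics.Permutations"
begin

text \<open>The underlying space is a finite-dimensional linear subspace of a real vector space
  (rather than a whole type), so that ideals are metric Lie algebras of the same kind as the
  algebra containing them, and the zero algebra is included.  The operations are total functions
  whose values outside the carrier are irrelevant.\<close>

record 'a metric_lie =
  carrier :: "'a set"
  bracket :: "'a \<Rightarrow> 'a \<Rightarrow> 'a"
  form :: "'a \<Rightarrow> 'a \<Rightarrow> real"

definition nondegenerate_on :: "('a::real_vector) metric_lie \<Rightarrow> 'a set \<Rightarrow> bool" where
  "nondegenerate_on g h \<longleftrightarrow> (\<forall>X\<in>h. (\<forall>Y\<in>h. form g X Y = 0) \<longrightarrow> X = 0)"

definition totally_isotropic :: "('a::real_vector) metric_lie \<Rightarrow> 'a set \<Rightarrow> bool" where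
  "totally_isotropic g h \<longleftrightarrow> (\<forall>X\<in>h. \<forall>Y\<in>h. form g X Y = 0)"

definition metric_lie_algebra :: "('a::real_vector) metric_lie \<Rightarrow> bool" where
  "metric_lie_algebra g \<longleftrightarrow>
     subspace (carrier g) \<and> (\<exists>S. finite S \<and> span S = carrier g) \<and>
     (\<forall>X\<in>carrier g. \<forall>Y\<in>carrier g. bracket g X Y \<in> carrier g) \<and>
     (\<forall>X\<in>carrier g. \<forall>Y\<in>carrier g. \<forall>Z\<in>carrier g. \<forall>a b.
        bracket g (a *\<^sub>R X + b *\<^sub>R Y) Z = a *\<^sub>R bracket g X Z + b *\<^sub>R bracket g Y Z \<and>
        bracket g Z (a *\<^sub>R X + b *\<^sub>R Y) = a *\<^sub>R bracket g Z X + b *\<^sub>R bracket g Z Y) \<and>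
     (\<forall>X\<in>carrier g. bracket g X X = 0) \<and>
     (\<forall>X\<in>carrier g. \<forall>Y\<in>carrier g. \<forall>Z\<in>carrier g.
        bracket g X (bracket g Y Z) + bracket g Y (bracket g Z X) + bracket g Z (bracket g X Y) = 0) \<and>
     (\<forall>X\<in>carrier g. \<forall>Y\<in>carrier g. \<forall>Z\<in>carrier g. \<forall>a b.
        form g (a *\<^sub>R X + b *\<^sub>R Y) Z = a * form g X Z + b * form g Y Z) \<and>
     (\<forall>X\<in>carrier g. \<forall>Y\<in>carrier g. form g X Y = form g Y X) \<and>
     nondegenerate_on g (carrier g)"

definition restrict_to :: "'a metric_lie \<Rightarrow> 'a set \<Rightarrow> 'a metric_lie" where
  "restrict_to g h = g\<lparr>carrier := h\<rparr>"

definition nabla :: "('a::real_vector) metric_lie \<Rightarrow> 'a \<Rightarrow> 'a \<Rightarrow> 'a" where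
  "nabla g X Y = (THE W. W \<in> carrier g \<and> (\<forall>Z\<in>carrier g.
     2 * form g W Z = form g (bracket g X Y) Z - form g (bracket g Y Z) X + form g (bracket g Z X) Y))"

text \<open>On a metric Lie algebra the description in \<open>nabla\<close> has exactly one solution.\<close>

lemma form_sum:
  assumes "metric_lie_algebra g" "finite T" "\<And>t. t \<in> T \<Longrightarrow> x t \<in> carrier g" "Z \<in> carrier g"
  shows "form g (\<Sum>t\<in>T. c t *\<^sub>R x t) Z = (\<Sum>t\<in>T. c t * form g (x t) Z)"
  using assms(2,3)
proof (induction T rule: finite_induct)
  case empty
  have "0 \<in> carrier g" using assms(1) by (simp add: metric_lie_algebra_def subspace_0)
  then have "form g (0 *\<^sub>R 0 + 0 *\<^sub>R 0) Z = 0"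
    using assms(1,4) unfolding metric_lie_algebra_def by (metis add.right_neutral mult_zero_left)
  then show ?case by simp
next
  case (insert t T)
  have S: "subspace (carrier g)" using assms(1) by (simp add: metric_lie_algebra_def)
  have "(\<Sum>t\<in>T. c t *\<^sub>R x t) \<in> carrier g"
    by (intro subspace_sum[OF S] subspace_scale[OF S]) (use insert in auto)
  then have "form g (c t *\<^sub>R x t + 1 *\<^sub>R (\<Sum>t\<in>T. c t *\<^sub>R x t)) Z
     = c t * form g (x t) Z + 1 * form g (\<Sum>t\<in>T. c t *\<^sub>R x t) Z"
    using assms(1,4) insert.prems unfolding metric_lie_algebra_def by blast
  with insert show ?case by simp
qed

lemma form_represent:
  assumes g: "metric_lie_algebra g"
    and l: "\<And>X Y a b. X \<in> carrier g \<Longrightarrow> Y \<in> carrier g \<Longrightarrow> l (a *\<^sub>R X + b *\<^sub>R Y) = a * l X + b * l Y"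
  shows "\<exists>!W. W \<in> carrier g \<and> (\<forall>Z\<in>carrier g. form g W Z = l Z)"
proof -
  let ?V = "carrier g"
  have S: "subspace ?V" using g by (simp add: metric_lie_algebra_def)
  obtain S0 where S0: "finite S0" "span S0 = ?V" using g by (auto simp: metric_lie_algebra_def)
  obtain B where B: "B \<subseteq> S0" "independent B" "S0 \<subseteq> span B"
    using maximal_independent_subset[of S0] by metis
  have fB: "finite B" using B S0 finite_subset by blast
  have spB: "span B = ?V" using B S0 by (metis span_mono span_span subset_antisym)
  have BV: "B \<subseteq> ?V" using spB span_superset by blast
  have sym: "form g X Y = form g Y X" if "X \<in> ?V" "Y \<in> ?V" for X Y
    using g that by (simp add: metric_lie_algebra_def)
  have nd: "X = 0" if "X \<in> ?V" "\<And>Y. Y \<in> ?V \<Longrightarrow> form g X Y = 0" for X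
    using g that by (auto simp: metric_lie_algebra_def nondegenerate_on_def)
  have lsum: "l (\<Sum>t\<in>T. c t *\<^sub>R t) = (\<Sum>t\<in>T. c t * l t)" if "finite T" "T \<subseteq> ?V" for c T
    using that
  proof (induction T rule: finite_induct)
    case empty
    show ?case using l[OF subspace_0[OF S] subspace_0[OF S], of 0 0] by simp
  next
    case (insert t T)
    have "(\<Sum>t\<in>T. c t *\<^sub>R t) \<in> ?V"
      by (intro subspace_sum[OF S] subspace_scale[OF S]) (use insert in auto)
    then have "l (c t *\<^sub>R t + 1 *\<^sub>R (\<Sum>t\<in>T. c t *\<^sub>R t)) = c t * l t + 1 * l (\<Sum>t\<in>T. c t *\<^sub>R t)"
      using insert.prems by (intro l) auto
    with insert show ?case by simp
  qed
  have rep: "\<exists>c. Z = (\<Sum>b\<in>B. c b *\<^sub>R b)" if "Z \<in> ?V" for Z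
    using that span_finite[OF fB] spB by auto
  define T where "T X = (\<Sum>b\<in>B. form g X b *\<^sub>R b)" for X
  have T0: "X = 0" if "X \<in> ?V" "T X = 0" for X
  proof (rule nd[OF that(1)])
    fix Y assume "Y \<in> ?V"
    then obtain c where c: "Y = (\<Sum>b\<in>B. c b *\<^sub>R b)" using rep by auto
    have z: "form g X b = 0" if "b \<in> B" for b
      using independentD[OF B(2) fB subset_refl] \<open>T X = 0\<close> that unfolding T_def by auto
    have "form g Y X = (\<Sum>b\<in>B. c b * form g b X)"
      unfolding c by (rule form_sum[OF g fB]) (use BV that in auto)
    also have "\<dots> = 0" using z BV that(1) by (intro sum.neutral) (auto simp: sym subset_iff)
    finally show "form g X Y = 0" using sym[OF \<open>Y \<in> ?V\<close> that(1)] by simp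
  qed
  have Tsum: "T (\<Sum>b\<in>B. c b *\<^sub>R b) = (\<Sum>b\<in>B. c b *\<^sub>R T b)" for c
  proof -
    have "T (\<Sum>b\<in>B. c b *\<^sub>R b) = (\<Sum>b'\<in>B. (\<Sum>b\<in>B. c b * form g b b') *\<^sub>R b')"
      unfolding T_def by (intro sum.cong refl arg_cong2[of _ _ _ _ scaleR] form_sum[OF g fB]) (use BV in auto)
    also have "\<dots> = (\<Sum>b\<in>B. \<Sum>b'\<in>B. (c b * form g b b') *\<^sub>R b')"
      by (simp only: scaleR_left.sum) (rule sum.swap)
    finally show ?thesis unfolding T_def by (simp add: scaleR_right.sum)
  qed
  obtain f where f: "linear f" "\<forall>b\<in>B. f b = T b"
    using linear_independent_extend[OF B(2), of T] by blast
  have fT: "f X = T X" if X: "X \<in> ?V" for X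
  proof -
    obtain c where c: "X = (\<Sum>b\<in>B. c b *\<^sub>R b)" using rep X by auto
    show ?thesis unfolding c Tsum using f by (simp add: linear_sum linear_cmul)
  qed
  have inj: "inj_on f ?V"
  proof (rule inj_onI)
    fix X Y assume XY: "X \<in> ?V" "Y \<in> ?V" "f X = f Y"
    have "X - Y \<in> ?V" using XY subspace_diff[OF S] by auto
    moreover have "f (X - Y) = 0" using XY f(1) by (simp add: linear_diff)
    ultimately show "X = Y" using T0[of "X - Y"] fT by auto
  qed
  have TV: "T X \<in> ?V" for X unfolding T_def
    by (intro subspace_sum[OF S] subspace_scale[OF S]) (use BV in auto)
  have ind: "independent (f ` B)"
    using linear_independent_injective_image[OF f(1) B(2)] inj spB by simp
  have cardfB: "card (f ` B) = card B" using inj BV card_image inj_on_subset by blast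
  have sub: "f ` B \<subseteq> ?V" using fT TV BV by auto
  have span: "?V \<subseteq> span (f ` B)"
  proof (rule ccontr)
    assume "\<not> ?thesis"
    then obtain v where v: "v \<in> ?V" "v \<notin> span (f ` B)" by auto
    then have "independent (insert v (f ` B))" "v \<notin> f ` B"
      using ind independent_insert[of v "f ` B"] span_base[of v "f ` B"] by (metis (no_types))+
    moreover have "insert v (f ` B) \<subseteq> span B" using v sub spB by auto
    ultimately have "card (insert v (f ` B)) \<le> card B"
      using independent_span_bound[OF fB] by blast
    then show False using \<open>v \<notin> f ` B\<close> cardfB fB by simp
  qed
  have "(\<Sum>b\<in>B. l b *\<^sub>R b) \<in> ?V"
    by (intro subspace_sum[OF S] subspace_scale[OF S]) (use BV in auto)
  then have "(\<Sum>b\<in>B. l b *\<^sub>R b) \<in> f ` ?V"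
    using span linear_span_image[OF f(1), of B] spB by auto
  then obtain W where W: "W \<in> ?V" "T W = (\<Sum>b\<in>B. l b *\<^sub>R b)" using fT by auto
  have Wb: "form g W b = l b" if "b \<in> B" for b
  proof -
    have "(\<Sum>b\<in>B. (form g W b - l b) *\<^sub>R b) = 0"
      using W(2) unfolding T_def by (simp add: scaleR_diff_left sum_subtractf)
    then show ?thesis using independentD[OF B(2) fB subset_refl, of "\<lambda>b. form g W b - l b"] that by auto
  qed
  have WZ: "form g W Z = l Z" if "Z \<in> ?V" for Z
  proof -
    obtain c where c: "Z = (\<Sum>b\<in>B. c b *\<^sub>R b)" using rep[OF \<open>Z \<in> ?V\<close>] by auto
    have "form g W Z = form g Z W" using sym W that by auto
    also have "\<dots> = (\<Sum>b\<in>B. c b * form g b W)"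
      unfolding c by (rule form_sum[OF g fB]) (use BV W in auto)
    also have "\<dots> = (\<Sum>b\<in>B. c b * l b)"
      by (intro sum.cong refl) (metis Wb sym W(1) BV subset_iff)
    also have "\<dots> = l Z" unfolding c using lsum[OF fB BV] by simp
    finally show ?thesis .
  qed
  show ?thesis
  proof (rule ex1I[of _ W])
    show "W \<in> ?V \<and> (\<forall>Z\<in>?V. form g W Z = l Z)" using W WZ by auto
  next
    fix W' assume W': "W' \<in> ?V \<and> (\<forall>Z\<in>?V. form g W' Z = l Z)"
    have "form g (1 *\<^sub>R W' + (-1) *\<^sub>R W) Z = 1 * form g W' Z + (-1) * form g W Z" if "Z \<in> ?V" for Z
      using g W' W(1) that unfolding metric_lie_algebra_def by blast
    then have "W' - W = 0" using W' W WZ by (intro nd subspace_diff[OF S]) auto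
    then show "W' = W" by simp
  qed
qed

lemma nabla_eqs:
  assumes g: "metric_lie_algebra g" and XY: "X \<in> carrier g" "Y \<in> carrier g"
  shows nabla_in_carrier: "nabla g X Y \<in> carrier g"
    and nabla_form: "Z \<in> carrier g \<Longrightarrow> 2 * form g (nabla g X Y) Z =
      form g (bracket g X Y) Z - form g (bracket g Y Z) X + form g (bracket g Z X) Y"
proof -
  let ?k = "\<lambda>Z. form g (bracket g X Y) Z - form g (bracket g Y Z) X + form g (bracket g Z X) Y"
  have br: "bracket g P Q \<in> carrier g" if "P \<in> carrier g" "Q \<in> carrier g" for P Q
    using g that by (simp add: metric_lie_algebra_def)
  have f1: "form g (a *\<^sub>R P + b *\<^sub>R Q) R = a * form g P R + b * form g Q R"
    if "P \<in> carrier g" "Q \<in> carrier g" "R \<in> carrier g" for a b P Q R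
    using g that unfolding metric_lie_algebra_def by blast
  have sym: "form g P Q = form g Q P" if "P \<in> carrier g" "Q \<in> carrier g" for P Q
    using g that by (simp add: metric_lie_algebra_def)
  have b1: "bracket g (a *\<^sub>R P + b *\<^sub>R Q) R = a *\<^sub>R bracket g P R + b *\<^sub>R bracket g Q R"
    and b2: "bracket g R (a *\<^sub>R P + b *\<^sub>R Q) = a *\<^sub>R bracket g R P + b *\<^sub>R bracket g R Q"
    if "P \<in> carrier g" "Q \<in> carrier g" "R \<in> carrier g" for a b P Q R
    using g that unfolding metric_lie_algebra_def by blast+
  have sub: "subspace (carrier g)" using g by (simp add: metric_lie_algebra_def)
  have f2: "form g R (a *\<^sub>R P + b *\<^sub>R Q) = a * form g R P + b * form g R Q"
    if "P \<in> carrier g" "Q \<in> carrier g" "R \<in> carrier g" for a b P Q R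
    using f1[OF that, of a b] sym that sub by (metis subspace_add subspace_scale)
  have "\<exists>!W. W \<in> carrier g \<and> (\<forall>Z\<in>carrier g. form g W Z = ?k Z / 2)"
    by (rule form_represent[OF g]) (simp add: XY br f1 f2 b1 b2, simp add: field_simps)
  then have "\<exists>!W. W \<in> carrier g \<and> (\<forall>Z\<in>carrier g. 2 * form g W Z = ?k Z)"
    by (simp add: field_simps)
  from theI'[OF this] have
    "nabla g X Y \<in> carrier g \<and> (\<forall>Z\<in>carrier g. 2 * form g (nabla g X Y) Z = ?k Z)"
    unfolding nabla_def .
  then show "nabla g X Y \<in> carrier g"
    and "Z \<in> carrier g \<Longrightarrow> 2 * form g (nabla g X Y) Z = ?k Z" by auto
qed

definition nabla_span :: "('a::real_vector) metric_lie \<Rightarrow> 'a set \<Rightarrow> 'a set \<Rightarrow> 'a set" where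
  "nabla_span g A B = span {nabla g X Y | X Y. X \<in> A \<and> Y \<in> B}"

definition Ann_R :: "('a::real_vector) metric_lie \<Rightarrow> 'a set" where
  "Ann_R g = {X \<in> carrier g. \<forall>Y\<in>carrier g. nabla g Y X = 0}"

definition Ann :: "('a::real_vector) metric_lie \<Rightarrow> 'a set" where
  "Ann g = {X \<in> carrier g. \<forall>Y\<in>carrier g. nabla g Y X = 0 \<and> nabla g X Y = 0}"

definition strong_ideal :: "('a::real_vector) metric_lie \<Rightarrow> 'a set \<Rightarrow> bool" where
  "strong_ideal g h \<longleftrightarrow> subspace h \<and> h \<subseteq> carrier g \<and>
     nabla_span g (carrier g) h \<subseteq> h \<and> nabla_span g h (carrier g) \<subseteq> h"

text \<open>The two summands are not required to be orthogonal.\<close>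

definition decomposable :: "('a::real_vector) metric_lie \<Rightarrow> bool" where
  "decomposable g \<longleftrightarrow> (\<exists>h k.
     strong_ideal g h \<and> nondegenerate_on g h \<and> h \<noteq> {0} \<and>
     strong_ideal g k \<and> nondegenerate_on g k \<and> k \<noteq> {0} \<and>
     h \<inter> k = {0} \<and> carrier g = {X + Y | X Y. X \<in> h \<and> Y \<in> k})"

abbreviation indecomposable :: "('a::real_vector) metric_lie \<Rightarrow> bool" where
  "indecomposable g \<equiv> \<not> decomposable g"

definition maximal_nondegenerate_subspace ::
    "('a::real_vector) metric_lie \<Rightarrow> 'a set \<Rightarrow> 'a set \<Rightarrow> bool" where
  "maximal_nondegenerate_subspace g A h \<longleftrightarrow>
     subspace h \<and> h \<subseteq> A \<and> nondegenerate_on g h \<and>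
     (\<forall>k. subspace k \<and> k \<subseteq> A \<and> nondegenerate_on g k \<and> h \<subseteq> k \<longrightarrow> k = h)"

definition orthogonal_direct_sum ::
    "('a::real_vector) metric_lie \<Rightarrow> 'i set \<Rightarrow> ('i \<Rightarrow> 'a set) \<Rightarrow> bool" where
  "orthogonal_direct_sum g I h \<longleftrightarrow>
     (\<forall>i\<in>I. subspace (h i)) \<and>
     carrier g = {\<Sum>i\<in>I. x i | x. \<forall>i\<in>I. x i \<in> h i} \<and>
     (\<forall>x. (\<forall>i\<in>I. x i \<in> h i) \<and> (\<Sum>i\<in>I. x i) = 0 \<longrightarrow> (\<forall>i\<in>I. x i = 0)) \<and>
     (\<forall>i\<in>I. \<forall>j\<in>I. i \<noteq> j \<longrightarrow> (\<forall>X\<in>h i. \<forall>Y\<in>h j. form g X Y = 0))"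

text \<open>The zeroth summand is the annihilator part, the summands indexed by \<open>{1..n}\<close> are the
  indecomposable factors.  Indecomposability and the right annihilator of a factor are those of
  the factor as a metric Lie algebra in its own right.\<close>

definition annihilator_decomposition ::
    "('a::real_vector) metric_lie \<Rightarrow> nat \<Rightarrow> (nat \<Rightarrow> 'a set) \<Rightarrow> bool" where
  "annihilator_decomposition g n h \<longleftrightarrow>
     orthogonal_direct_sum g {0..n} h \<and>
     maximal_nondegenerate_subspace g (Ann g) (h 0) \<and>
     (\<forall>i\<in>{1..n}. h i \<noteq> {0} \<and> strong_ideal g (h i) \<and> nondegenerate_on g (h i) \<and>
        indecomposable (restrict_to g (h i)) \<and>
        totally_isotropic g (Ann_R (restrict_to g (h i))))"

definition strong_isometry ::
    "('a::real_vector) metric_lie \<Rightarrow> ('b::real_vector) metric_lie \<Rightarrow> ('a \<Rightarrow> 'b) \<Rightarrow> bool" where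
  "strong_isometry g g' f \<longleftrightarrow>
     bij_betw f (carrier g) (carrier g') \<and>
     (\<forall>X\<in>carrier g. \<forall>Y\<in>carrier g. \<forall>a b. f (a *\<^sub>R X + b *\<^sub>R Y) = a *\<^sub>R f X + b *\<^sub>R f Y) \<and>
     (\<forall>X\<in>carrier g. \<forall>Y\<in>carrier g. f (nabla g X Y) = nabla g' (f X) (f Y)) \<and>
     (\<forall>X\<in>carrier g. \<forall>Y\<in>carrier g. form g' (f X) (f Y) = form g X Y)"

text \<open>On a direct sum with summands \<open>h i\<close> this determines \<open>F\<close> on the carrier.\<close>

definition is_direct_sum_map ::
    "'i set \<Rightarrow> ('i \<Rightarrow> ('a::real_vector) set) \<Rightarrow> ('i \<Rightarrow> 'a \<Rightarrow> 'b::real_vector) \<Rightarrow> ('a \<Rightarrow> 'b) \<Rightarrow> bool" where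
  "is_direct_sum_map I h f F \<longleftrightarrow>
     (\<forall>x. (\<forall>i\<in>I. x i \<in> h i) \<longrightarrow> F (\<Sum>i\<in>I. x i) = (\<Sum>i\<in>I. f i (x i)))"

end

theory Submission
  imports Defs
begin

text \<open>
  By skewness of \<open>nabla g X\<close>, the orthogonal complement of \<open>nabla_span g V V\<close> is the right annihilator,
  here equal to the annihilator.  Let \<open>h\<close> be an indecomposable factor with complementary ideal
  \<open>h'\<close>, and let \<open>P\<close>, \<open>Q\<close> be orthogonal strong ideals with sum \<open>V\<close>.  The spans of \<open>nabla g h P\<close>
  and \<open>nabla g h Q\<close> are orthogonal, meet trivially and lie in \<open>h\<close>, so they extend to an
  orthogonal non-degenerate splitting of \<open>h\<close>; its parts are strong ideals because an element
  of \<open>h\<close> orthogonal to \<open>nabla g h Q\<close> agrees modulo the annihilator with its component in \<open>P\<close>.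
  Hence one of the two spans vanishes, which matches the factors of the two decompositions.

  For matched factors \<open>h\<close> and \<open>P\<close>, projection to \<open>P\<close> preserves the product and is the identity
  on \<open>nabla g h h\<close>.  Its failure to be isometric takes values in the annihilator and is
  corrected by an operator into the totally isotropic right annihilator of \<open>h\<close>.
\<close>

section \<open>Orthogonal complements, restrictions and linear projections\<close>

definition perp :: "('a::real_vector) metric_lie \<Rightarrow> 'a set \<Rightarrow> 'a set" where
  "perp g A = {x \<in> carrier g. \<forall>y\<in>A. form g x y = 0}"

lemma carrier_restrict_to [simp]: "carrier (restrict_to g h) = h"
  and form_restrict_to [simp]: "form (restrict_to g h) = form g"
  and bracket_restrict_to [simp]: "bracket (restrict_to g h) = bracket g"
  by (simp_all add: restrict_to_def)

lemma nondegenerate_on_restrict_to [simp]: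
  "nondegenerate_on (restrict_to g h) k = nondegenerate_on g k"
  by (simp add: nondegenerate_on_def)

lemma finite_span_subspace:
  fixes h :: "('a::real_vector) set"
  assumes "finite S" "subspace h" "h \<subseteq> span S"
  shows "\<exists>T. finite T \<and> span T = h"
proof -
  obtain B where B: "B \<subseteq> h" "independent B" "h \<subseteq> span B"
    using maximal_independent_subset[of h] by metis
  have "finite B"
    using independent_span_bound[OF assms(1) B(2)] B(1) assms(3) by blast
  moreover have "span B = h"
    using B assms(2) by (simp add: span_minimal subset_antisym)
  ultimately show ?thesis by blast
qed

lemma exists_projection_onto_subspace:
  fixes A :: "('a::real_vector) set"
  assumes "subspace A"
  shows "\<exists>p. linear p \<and> range p \<subseteq> A \<and> (\<forall>x\<in>A. p x = x)"
  using linear_exists_left_inverse_on[OF linear_ident assms] by auto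

text \<open>If \<open>a\<close> projects onto \<open>A\<close>, then \<open>r = id - a\<close> kills
  \<open>A\<close>, and its kernel lies in \<open>A\<close>, so \<open>r\<close> is injective on
  \<open>R\<close>. A left inverse of \<open>r\<close> on \<open>R\<close>, composed with
  \<open>r\<close>, is the wanted projection.\<close>

lemma exists_projection_killing_subspace:
  fixes A R :: "('a::real_vector) set"
  assumes A: "subspace A" and R: "subspace R" and AR: "A \<inter> R = {0}"
  shows "\<exists>p. linear p \<and> range p \<subseteq> R \<and> (\<forall>x\<in>R. p x = x) \<and> (\<forall>x\<in>A. p x = 0)"
proof -
  obtain a where a: "linear a" "range a \<subseteq> A" "\<forall>x\<in>A. a x = x"
    using exists_projection_onto_subspace[OF A] by blast
  define r where "r x = x - a x" for x
  have r: "linear r"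
    unfolding r_def using a(1) by (intro linear_compose_sub linear_ident) auto
  have "inj_on r R"
  proof (rule inj_onI)
    fix x y assume xy: "x \<in> R" "y \<in> R" "r x = r y"
    then have "a (x - y) = x - y"
      using a(1) by (simp add: r_def linear_diff algebra_simps)
    then have "x - y \<in> A" using a(2) rangeI[of a "x - y"] by auto
    moreover have "x - y \<in> R" using xy R by (simp add: subspace_diff)
    ultimately have "x - y \<in> A \<inter> R" by blast
    then show "x = y" by (simp add: AR)
  qed
  then obtain q where q: "range q \<subseteq> R" "linear q" "\<forall>x\<in>R. q (r x) = x"
    using linear_exists_left_inverse_on[OF r R] by blast
  have "linear (q \<circ> r)" using r q(2) by (rule linear_compose)
  moreover have "range (q \<circ> r) \<subseteq> R" using q(1) by auto
  moreover have "\<forall>x\<in>A. (q \<circ> r) x = 0" using a(3) q(2) by (simp add: r_def linear_0)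
  ultimately show ?thesis using q(3) by (metis comp_apply)
qed

section \<open>Calculus of the form, the bracket and the Levi-Civita product\<close>

locale metric_lie =
  fixes g :: "('a::real_vector) metric_lie"
  assumes metric_lie_algebra: "metric_lie_algebra g"
begin

abbreviation V where "V \<equiv> carrier g"
abbreviation N where "N \<equiv> nabla g"
abbreviation B where "B \<equiv> form g"

lemma subspace_carrier [simp]: "subspace V"
  using metric_lie_algebra by (simp add: metric_lie_algebra_def)

lemma carrier_closed [simp, intro]:
  "0 \<in> V"
  "x \<in> V \<Longrightarrow> y \<in> V \<Longrightarrow> x + y \<in> V"
  "x \<in> V \<Longrightarrow> y \<in> V \<Longrightarrow> x - y \<in> V"
  "x \<in> V \<Longrightarrow> a *\<^sub>R x \<in> V"
  "x \<in> V \<Longrightarrow> - x \<in> V"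
  "x \<in> V \<Longrightarrow> y \<in> V \<Longrightarrow> bracket g x y \<in> V"
  "x \<in> V \<Longrightarrow> y \<in> V \<Longrightarrow> N x y \<in> V"
  using metric_lie_algebra nabla_in_carrier[OF metric_lie_algebra]
  by (auto simp: metric_lie_algebra_def subspace_0 subspace_add subspace_diff subspace_scale subspace_neg)

lemma form_sym: "x \<in> V \<Longrightarrow> y \<in> V \<Longrightarrow> B x y = B y x"
  using metric_lie_algebra by (simp add: metric_lie_algebra_def)

lemma form_lin_left:
  assumes "x \<in> V" "y \<in> V" "z \<in> V"
  shows "B (a *\<^sub>R x + b *\<^sub>R y) z = a * B x z + b * B y z"
  using metric_lie_algebra assms unfolding metric_lie_algebra_def by blast

lemma form_lin_right:
  assumes "x \<in> V" "y \<in> V" "z \<in> V"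
  shows "B z (a *\<^sub>R x + b *\<^sub>R y) = a * B z x + b * B z y"
  using form_lin_left[OF assms, of a b] assms
  by (simp only: form_sym[of z x] form_sym[of z y] form_sym[of z "a *\<^sub>R x + b *\<^sub>R y"] carrier_closed)

lemma form_simps [simp]:
  assumes "x \<in> V" "z \<in> V"
  shows "y \<in> V \<Longrightarrow> B (x + y) z = B x z + B y z"
    and "y \<in> V \<Longrightarrow> B z (x + y) = B z x + B z y"
    and "y \<in> V \<Longrightarrow> B (x - y) z = B x z - B y z"
    and "y \<in> V \<Longrightarrow> B z (x - y) = B z x - B z y"
    and "B (a *\<^sub>R x) z = a * B x z"
    and "B z (a *\<^sub>R x) = a * B z x"
    and "B (- x) z = - B x z"
    and "B z (- x) = - B z x"
  using form_lin_left[of x y z 1 1] form_lin_right[of x y z 1 1]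
    form_lin_left[of x y z 1 "-1"] form_lin_right[of x y z 1 "-1"]
    form_lin_left[of x x z a 0] form_lin_right[of x x z a 0]
    form_lin_left[of x x z "-1" 0] form_lin_right[of x x z "-1" 0] assms
  by simp_all

lemma form_zero [simp]:
  assumes "z \<in> V"
  shows "B 0 z = 0" "B z 0 = 0"
  using form_simps(5,6)[of z z 0] assms by simp_all

lemma form_sum_left:
  assumes "finite I" "\<And>i. i \<in> I \<Longrightarrow> x i \<in> V" "z \<in> V"
  shows "B (\<Sum>i\<in>I. x i) z = (\<Sum>i\<in>I. B (x i) z)"
  using form_sum[where c = "\<lambda>_. 1", OF metric_lie_algebra assms] by simp

lemma carrier_sum [intro]: "(\<And>i. i \<in> I \<Longrightarrow> x i \<in> V) \<Longrightarrow> (\<Sum>i\<in>I. x i) \<in> V"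
  by (rule subspace_sum[OF subspace_carrier])

lemma form_sum_right:
  assumes "finite I" "\<And>i. i \<in> I \<Longrightarrow> x i \<in> V" "z \<in> V"
  shows "B z (\<Sum>i\<in>I. x i) = (\<Sum>i\<in>I. B z (x i))"
proof -
  have "B z (\<Sum>i\<in>I. x i) = B (\<Sum>i\<in>I. x i) z" using assms by (intro form_sym) auto
  also have "\<dots> = (\<Sum>i\<in>I. B (x i) z)" by (rule form_sum_left[OF assms])
  also have "\<dots> = (\<Sum>i\<in>I. B z (x i))" using assms by (intro sum.cong form_sym) auto
  finally show ?thesis .
qed

lemma form_zeroD: "x \<in> V \<Longrightarrow> (\<And>z. z \<in> V \<Longrightarrow> B x z = 0) \<Longrightarrow> x = 0"
  using metric_lie_algebra by (auto simp: metric_lie_algebra_def nondegenerate_on_def)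

lemma form_eqI:
  assumes "x \<in> V" "y \<in> V" "\<And>z. z \<in> V \<Longrightarrow> B x z = B y z"
  shows "x = y"
  using form_zeroD[of "x - y"] assms by simp

lemma bracket_lin:
  assumes "x \<in> V" "y \<in> V" "z \<in> V"
  shows "bracket g (a *\<^sub>R x + b *\<^sub>R y) z = a *\<^sub>R bracket g x z + b *\<^sub>R bracket g y z"
    and "bracket g z (a *\<^sub>R x + b *\<^sub>R y) = a *\<^sub>R bracket g z x + b *\<^sub>R bracket g z y"
  using metric_lie_algebra assms unfolding metric_lie_algebra_def by blast+

lemma bracket_self [simp]: "x \<in> V \<Longrightarrow> bracket g x x = 0"
  using metric_lie_algebra by (simp add: metric_lie_algebra_def)

lemma bracket_antisym:
  assumes "x \<in> V" "y \<in> V"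
  shows "bracket g y x = (-1) *\<^sub>R bracket g x y"
proof -
  have "bracket g (1 *\<^sub>R x + 1 *\<^sub>R y) (1 *\<^sub>R x + 1 *\<^sub>R y) = 0"
    using assms by (intro bracket_self) auto
  then have "bracket g x y + bracket g y x = 0"
    using bracket_lin(1)[OF assms, of "x + y" 1 1] bracket_lin(2)[OF assms, of _ 1 1] assms by simp
  then show ?thesis by (simp add: eq_neg_iff_add_eq_0 add.commute)
qed

lemma koszul:
  assumes "x \<in> V" "y \<in> V" "z \<in> V"
  shows "2 * B (N x y) z = B (bracket g x y) z - B (bracket g y z) x + B (bracket g z x) y"
  using nabla_form[OF metric_lie_algebra assms] .

lemma nabla_lin_left:
  assumes "x \<in> V" "y \<in> V" "z \<in> V"
  shows "N (a *\<^sub>R x + b *\<^sub>R y) z = a *\<^sub>R N x z + b *\<^sub>R N y z"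
proof (rule form_eqI)
  fix w assume w: "w \<in> V"
  have "2 * B (N (a *\<^sub>R x + b *\<^sub>R y) z) w = a * (2 * B (N x z) w) + b * (2 * B (N y z) w)"
    using assms w by (simp add: koszul bracket_lin) (simp add: algebra_simps)
  then show "B (N (a *\<^sub>R x + b *\<^sub>R y) z) w = B (a *\<^sub>R N x z + b *\<^sub>R N y z) w"
    using assms w by simp
qed (use assms in auto)

lemma nabla_lin_right:
  assumes "x \<in> V" "y \<in> V" "z \<in> V"
  shows "N z (a *\<^sub>R x + b *\<^sub>R y) = a *\<^sub>R N z x + b *\<^sub>R N z y"
proof (rule form_eqI)
  fix w assume w: "w \<in> V"
  have "2 * B (N z (a *\<^sub>R x + b *\<^sub>R y)) w = a * (2 * B (N z x) w) + b * (2 * B (N z y) w)"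
    using assms w by (simp add: koszul bracket_lin) (simp add: algebra_simps)
  then show "B (N z (a *\<^sub>R x + b *\<^sub>R y)) w = B (a *\<^sub>R N z x + b *\<^sub>R N z y) w"
    using assms w by simp
qed (use assms in auto)

lemma nabla_simps [simp]:
  assumes "x \<in> V" "z \<in> V"
  shows "y \<in> V \<Longrightarrow> N (x + y) z = N x z + N y z"
    and "y \<in> V \<Longrightarrow> N z (x + y) = N z x + N z y"
    and "y \<in> V \<Longrightarrow> N (x - y) z = N x z - N y z"
    and "y \<in> V \<Longrightarrow> N z (x - y) = N z x - N z y"
    and "N (a *\<^sub>R x) z = a *\<^sub>R N x z"
    and "N z (a *\<^sub>R x) = a *\<^sub>R N z x"
  using nabla_lin_left[of x y z 1 1] nabla_lin_right[of x y z 1 1]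
    nabla_lin_left[of x y z 1 "-1"] nabla_lin_right[of x y z 1 "-1"]
    nabla_lin_left[of x x z a 0] nabla_lin_right[of x x z a 0] assms
  by simp_all

lemma nabla_zero [simp]:
  assumes "z \<in> V"
  shows "N 0 z = 0" "N z 0 = 0"
  using nabla_simps(5,6)[of z z 0] assms by simp_all

lemma nabla_sum_left:
  assumes "finite I" "\<And>i. i \<in> I \<Longrightarrow> x i \<in> V" "z \<in> V"
  shows "N (\<Sum>i\<in>I. x i) z = (\<Sum>i\<in>I. N (x i) z)"
  using assms by (induction I rule: finite_induct) (auto simp: carrier_sum)

lemma nabla_sum_right:
  assumes "finite I" "\<And>i. i \<in> I \<Longrightarrow> x i \<in> V" "z \<in> V"
  shows "N z (\<Sum>i\<in>I. x i) = (\<Sum>i\<in>I. N z (x i))"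
  using assms by (induction I rule: finite_induct) (auto simp: carrier_sum)

text \<open>Compatibility with the metric: exchanging \<open>y\<close> and \<open>z\<close> in the
  Koszul formula reverses its sign.\<close>

lemma nabla_skew:
  assumes "x \<in> V" "y \<in> V" "z \<in> V"
  shows "B (N x y) z = - B y (N x z)"
proof -
  have "2 * B (N x y) z = - (2 * B (N x z) y)"
    using assms koszul[of x y z] koszul[of x z y] bracket_antisym[of x z] bracket_antisym[of x y]
      bracket_antisym[of y z] by simp
  then show ?thesis using assms form_sym[of y "N x z"] by simp
qed

text \<open>Torsion-freeness, from the difference of two Koszul formulas. It makes every subspace
  closed under \<open>N\<close> a subalgebra.\<close>

lemma bracket_nabla:
  assumes "x \<in> V" "y \<in> V"
  shows "bracket g x y = N x y - N y x"
proof (rule form_eqI)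
  fix z assume z: "z \<in> V"
  have "2 * B (bracket g x y) z = 2 * B (N x y) z - 2 * B (N y x) z"
    using assms z koszul[of x y z] koszul[of y x z] bracket_antisym[of x z] bracket_antisym[of x y]
      bracket_antisym[of y z] by simp
  then show "B (bracket g x y) z = B (N x y - N y x) z" using assms z by simp
qed (use assms in auto)

section \<open>Duality and non-degenerate complements\<close>

lemma form_represent_on:
  assumes h: "subspace h" "h \<subseteq> V" "nondegenerate_on g h"
    and l: "\<And>x y a b. x \<in> h \<Longrightarrow> y \<in> h \<Longrightarrow> l (a *\<^sub>R x + b *\<^sub>R y) = a * l x + b * l y"
  shows "\<exists>w\<in>h. \<forall>z\<in>h. B w z = l z"
proof -
  \<comment> \<open>\<open>h\<close> need not be closed under the bracket, so make it an abelian metric Lie algebra.\<close>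
  let ?k = "\<lparr>carrier = h, bracket = \<lambda>_ _. 0, form = B\<rparr>"
  obtain S where "finite S" "span S = V"
    using metric_lie_algebra by (auto simp: metric_lie_algebra_def)
  then have "\<exists>T. finite T \<and> span T = h" using finite_span_subspace h by metis
  then have "metric_lie_algebra ?k"
    unfolding metric_lie_algebra_def using h subspace_0[OF h(1)] form_lin_left form_sym
    by (simp add: nondegenerate_on_def subset_iff)
  from form_represent[OF this, of l] show ?thesis using l by auto
qed

lemma subspace_perp [simp]: "A \<subseteq> V \<Longrightarrow> subspace (perp g A)"
  by (auto simp: perp_def subset_iff intro!: subspaceI)

text \<open>A vector \<open>v\<close> outside \<open>W\<close> is separated from \<open>W\<close> by
  a linear functional vanishing on \<open>W\<close>. The vector \<open>u\<close> representing that
  functional lies in \<open>perp g W\<close> but is not orthogonal to \<open>v\<close>.\<close>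

lemma perp_perp_subset:
  assumes W: "subspace W" "W \<subseteq> V"
  shows "perp g (perp g W) \<subseteq> W"
proof
  fix v assume v: "v \<in> perp g (perp g W)"
  obtain p where p: "linear p" "range p \<subseteq> W" "\<forall>x\<in>W. p x = x"
    using exists_projection_onto_subspace[OF W(1)] by blast
  show "v \<in> W"
  proof (rule ccontr)
    assume "v \<notin> W"
    then have nz: "v - p v \<noteq> 0" using p(2) by auto
    obtain f :: "'a \<Rightarrow> real" where f: "linear f" "f (v - p v) = 1"
      using linear_independent_extend[of "{v - p v}" "\<lambda>_. 1"] nz by auto
    \<comment> \<open>Subtracting the projection makes \<open>l\<close> vanish on \<open>W\<close>
      and keeps \<open>l v = 1\<close>.\<close>
    define l where "l z = f (z - p z)" for z
    have "l (a *\<^sub>R x + b *\<^sub>R y) = a * l x + b * l y" for a b x y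
      using f(1) p(1) by (simp add: l_def linear_add linear_diff linear_cmul algebra_simps)
    then obtain u where u: "u \<in> V" "\<forall>z\<in>V. B u z = l z"
      using form_represent[OF metric_lie_algebra, of l] by blast
    have "u \<in> perp g W" using u W p f(1) by (auto simp: perp_def l_def linear_0)
    then have "B v u = 0" using v by (auto simp: perp_def)
    moreover have "B u v = 1" using u v f by (auto simp: perp_def l_def)
    ultimately show False using form_sym[of u v] u v by (auto simp: perp_def)
  qed
qed

text \<open>The functional \<open>B x\<close> restricted to \<open>H\<close> is represented by a
  vector of \<open>H\<close>, which is the orthogonal projection of \<open>x\<close>.\<close>

lemma orthogonal_split_nondegenerate:
  assumes H: "subspace H" "H \<subseteq> V" "nondegenerate_on g H" and x: "x \<in> V"
  shows "\<exists>y\<in>H. x - y \<in> perp g H"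
proof -
  obtain y where y: "y \<in> H" "\<forall>z\<in>H. B y z = B x z"
    using form_represent_on[OF H, of "B x"] form_lin_right x H(2) by (meson subsetD)
  have "x - y \<in> perp g H" using x y H(2) by (auto simp: perp_def subset_iff)
  with y show ?thesis by blast
qed

text \<open>\<open>A\<close> and \<open>C\<close> may be degenerate. The radical of
  \<open>perp g C\<close> is \<open>R = C \<inter> perp g C\<close>, by the double complement, so
  any complement of \<open>R\<close> in \<open>perp g C\<close> is non-degenerate. As
  \<open>A\<close> meets \<open>R\<close> trivially, the complement can be taken to contain
  \<open>A\<close>.\<close>

lemma exists_nondegenerate_splitting:
  assumes A: "subspace A" "A \<subseteq> V" and C: "subspace C" "C \<subseteq> V"
    and orth: "\<And>x y. x \<in> A \<Longrightarrow> y \<in> C \<Longrightarrow> B x y = 0" and AC: "A \<inter> C = {0}"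
  shows "\<exists>H. subspace H \<and> nondegenerate_on g H \<and> H \<subseteq> V \<and> A \<subseteq> H \<and> C \<subseteq> perp g H"
proof -
  define R where "R = C \<inter> perp g C"
  have R: "subspace R" unfolding R_def using C by (intro subspace_inter) auto
  have "A \<inter> R = {0}" using AC subspace_0[OF R] by (auto simp: R_def)
  then obtain p where p: "linear p" "range p \<subseteq> R" "\<forall>x\<in>R. p x = x" "\<forall>x\<in>A. p x = 0"
    using exists_projection_killing_subspace[OF A(1) R] by blast
  \<comment> \<open>a complement of the radical of \<open>C\<close> in \<open>perp g C\<close> that contains \<open>A\<close>\<close>
  define H where "H = {x \<in> perp g C. p x = 0}"
  have sH: "subspace H"
    using subspace_perp[OF C(2)] p(1) unfolding H_def subspace_def
    by (auto simp: linear_0 linear_add linear_cmul)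
  have HV: "H \<subseteq> V" by (auto simp: H_def perp_def)
  have AH: "A \<subseteq> H" using A orth p(4) by (auto simp: H_def perp_def)
  have CH: "C \<subseteq> perp g H"
  proof
    fix c assume c: "c \<in> C"
    have "B c x = 0" if "x \<in> H" for x
      using that c C form_sym[of c x] by (auto simp: H_def perp_def)
    then show "c \<in> perp g H" using c C by (auto simp: perp_def)
  qed
  have "nondegenerate_on g H"
    unfolding nondegenerate_on_def
  proof (intro ballI impI)
    fix x assume x: "x \<in> H" "\<forall>y\<in>H. B x y = 0"
    have xV: "x \<in> V" using x HV by auto
    \<comment> \<open>Write \<open>y\<close> as \<open>y - p y\<close>, which lies in
      \<open>H\<close>, plus \<open>p y\<close>, which lies in \<open>C\<close>; \<open>x\<close> is
      orthogonal to both.\<close>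
    have "B x y = 0" if y: "y \<in> perp g C" for y
    proof -
      have pR: "p y \<in> R" using p(2) by auto
      then have pV: "p y \<in> V" "p y \<in> C" "p y \<in> perp g C" using C by (auto simp: R_def)
      have "y - p y \<in> H"
        using y pR pV p(1,3) subspace_diff[OF subspace_perp[OF C(2)]] by (simp add: H_def linear_diff)
      then have "B x (y - p y) = 0" using x by auto
      moreover have "B x (p y) = 0" using x pV by (auto simp: H_def perp_def)
      ultimately show ?thesis using xV pV y by (simp add: perp_def)
    qed
    then have "x \<in> perp g (perp g C)" using xV by (auto simp: perp_def)
    then have "x \<in> C" using perp_perp_subset[OF C] by auto
    then have "x \<in> R" using x by (auto simp: R_def H_def)
    then show "x = 0" using p(3) x by (auto simp: H_def)
  qed
  then show ?thesis using sH HV AH CH by blast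
qed

section \<open>Spans of products, the annihilator and restriction to subalgebras\<close>

lemma nabla_in_nabla_span: "x \<in> A \<Longrightarrow> y \<in> C \<Longrightarrow> N x y \<in> nabla_span g A C"
  unfolding nabla_span_def by (auto intro!: span_base)

lemma nabla_span_subset:
  "subspace W \<Longrightarrow> (\<And>x y. x \<in> A \<Longrightarrow> y \<in> C \<Longrightarrow> N x y \<in> W) \<Longrightarrow> nabla_span g A C \<subseteq> W"
  unfolding nabla_span_def by (rule span_minimal) auto

lemma nabla_span_subset_iff:
  assumes "subspace W"
  shows "nabla_span g A C \<subseteq> W \<longleftrightarrow> (\<forall>x\<in>A. \<forall>y\<in>C. N x y \<in> W)"
  using nabla_span_subset[OF assms, of A C] nabla_in_nabla_span[of _ A _ C] by (meson subsetD)

lemma strong_ideal_iff: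
  "strong_ideal g h \<longleftrightarrow> subspace h \<and> h \<subseteq> V \<and> (\<forall>x\<in>V. \<forall>y\<in>h. N x y \<in> h \<and> N y x \<in> h)"
  unfolding strong_ideal_def by (cases "subspace h") (auto simp: nabla_span_subset_iff)

lemma nabla_span_eq_zero_iff: "nabla_span g A C = {0} \<longleftrightarrow> (\<forall>x\<in>A. \<forall>y\<in>C. N x y = 0)"
proof
  assume "\<forall>x\<in>A. \<forall>y\<in>C. N x y = 0"
  then have "nabla_span g A C \<subseteq> {0}" by (intro nabla_span_subset) auto
  then show "nabla_span g A C = {0}" by (auto simp: nabla_span_def span_zero)
qed (use nabla_in_nabla_span in blast)

lemma subspace_nabla_span [simp]: "subspace (nabla_span g A C)"
  by (simp add: nabla_span_def)

lemma nabla_cong_Ann: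
  assumes "x \<in> V" "x' \<in> V" "y \<in> V" "y' \<in> V" "x - x' \<in> Ann g" "y - y' \<in> Ann g"
  shows "N x y = N x' y'"
proof -
  have "N (x - x') y = 0" "N x' (y - y') = 0" using assms by (auto simp: Ann_def)
  then show ?thesis using assms by simp
qed

lemma nabla_span_subset_mod_Ann:
  assumes "A \<subseteq> V" "C \<subseteq> V" "A' \<subseteq> V" "C' \<subseteq> V"
    and "\<And>x. x \<in> A \<Longrightarrow> \<exists>x'\<in>A'. x - x' \<in> Ann g" "\<And>y. y \<in> C \<Longrightarrow> \<exists>y'\<in>C'. y - y' \<in> Ann g"
  shows "nabla_span g A C \<subseteq> nabla_span g A' C'"
proof (rule nabla_span_subset)
  fix x y assume xy: "x \<in> A" "y \<in> C"
  obtain x' y' where "x' \<in> A'" "x - x' \<in> Ann g" "y' \<in> C'" "y - y' \<in> Ann g"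
    using assms(5)[OF xy(1)] assms(6)[OF xy(2)] by blast
  moreover from this have "N x y = N x' y'"
    using assms(1-4) xy by (intro nabla_cong_Ann) auto
  ultimately show "N x y \<in> nabla_span g A' C'" by (simp add: nabla_in_nabla_span)
qed simp

lemma subspace_Ann [simp]: "subspace (Ann g)"
  by (rule subspaceI) (auto simp: Ann_def)

text \<open>The product of \<open>restrict_to g h\<close> is determined by testing against
  \<open>h\<close> only. Since \<open>N x y\<close> already lies in \<open>h\<close> and satisfies
  the same Koszul formula there, non-degeneracy on \<open>h\<close> identifies the two
  products.\<close>

lemma
  assumes h: "subspace h" "h \<subseteq> V" "nondegenerate_on g h"
    and closed: "\<And>x y. x \<in> h \<Longrightarrow> y \<in> h \<Longrightarrow> N x y \<in> h"
  shows metric_lie_restrict_to: "metric_lie (restrict_to g h)"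
    and nabla_restrict_to: "x \<in> h \<Longrightarrow> y \<in> h \<Longrightarrow> nabla (restrict_to g h) x y = N x y"
proof -
  have hV: "x \<in> V" if "x \<in> h" for x using that h(2) by auto
  obtain S where "finite S" "span S = V"
    using metric_lie_algebra by (auto simp: metric_lie_algebra_def)
  then have fin: "\<exists>T. finite T \<and> span T = h" using finite_span_subspace h by metis
  have br: "bracket g x y \<in> h" if "x \<in> h" "y \<in> h" for x y
    using that closed h by (simp add: bracket_nabla hV subspace_diff)
  have jac: "bracket g x (bracket g y z) + bracket g y (bracket g z x) + bracket g z (bracket g x y) = 0"
    if "x \<in> V" "y \<in> V" "z \<in> V" for x y z
    using metric_lie_algebra that by (simp add: metric_lie_algebra_def)
  have mla: "metric_lie_algebra (restrict_to g h)"
    unfolding metric_lie_algebra_def carrier_restrict_to form_restrict_to bracket_restrict_to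
      nondegenerate_on_restrict_to
    by (intro conjI ballI allI h fin br form_lin_left bracket_lin form_sym bracket_self jac hV; assumption)
  then interpret R: metric_lie "restrict_to g h" by unfold_locales
  show "metric_lie (restrict_to g h)" by (rule R.metric_lie_axioms)
  show "nabla (restrict_to g h) x y = N x y" if xy: "x \<in> h" "y \<in> h"
  proof (rule R.form_eqI)
    fix z assume "z \<in> carrier (restrict_to g h)"
    then have z: "z \<in> h" by simp
    have "2 * B (nabla (restrict_to g h) x y) z = 2 * B (N x y) z"
      using R.koszul[of x y z] koszul[of x y z] xy z hV by simp
    then show "form (restrict_to g h) (nabla (restrict_to g h) x y) z = form (restrict_to g h) (N x y) z"
      by simp
  qed (use xy closed R.carrier_closed(7) in auto)
qed

section \<open>Orthogonal splittings into two strong ideals\<close>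

text \<open>An orthogonal direct sum decomposition of \<open>V\<close> into two strong ideals: the
  last clause says \<open>V = P + Q\<close>, while directness and non-degeneracy of both parts
  follow from non-degeneracy on \<open>V\<close>.\<close>

definition ideal_splitting :: "'a set \<Rightarrow> 'a set \<Rightarrow> bool" where
  "ideal_splitting P Q \<longleftrightarrow> strong_ideal g P \<and> strong_ideal g Q \<and>
     (\<forall>x\<in>P. \<forall>y\<in>Q. B x y = 0) \<and> (\<forall>x\<in>V. \<exists>p\<in>P. x - p \<in> Q)"

lemma ideal_splittingD:
  assumes "ideal_splitting P Q"
  shows "subspace P" "subspace Q" "P \<subseteq> V" "Q \<subseteq> V"
    and "x \<in> P \<Longrightarrow> x \<in> V" "y \<in> Q \<Longrightarrow> y \<in> V"
    and "x \<in> P \<Longrightarrow> y \<in> Q \<Longrightarrow> B x y = 0" "x \<in> P \<Longrightarrow> y \<in> Q \<Longrightarrow> B y x = 0"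
    and "z \<in> V \<Longrightarrow> x \<in> P \<Longrightarrow> N z x \<in> P" "z \<in> V \<Longrightarrow> x \<in> P \<Longrightarrow> N x z \<in> P"
    and "z \<in> V \<Longrightarrow> y \<in> Q \<Longrightarrow> N z y \<in> Q" "z \<in> V \<Longrightarrow> y \<in> Q \<Longrightarrow> N y z \<in> Q"
    and "z \<in> V \<Longrightarrow> \<exists>p\<in>P. z - p \<in> Q"
proof -
  show "x \<in> P \<Longrightarrow> y \<in> Q \<Longrightarrow> B y x = 0"
    using assms form_sym[of x y] by (auto simp: ideal_splitting_def strong_ideal_iff)
qed (use assms in \<open>auto simp: ideal_splitting_def strong_ideal_iff\<close>)

lemma ideal_splitting_sym:
  assumes "ideal_splitting P Q"
  shows "ideal_splitting Q P"
  unfolding ideal_splitting_def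
proof (intro conjI ballI)
  show "strong_ideal g Q" "strong_ideal g P" using assms by (auto simp: ideal_splitting_def)
  show "B x y = 0" if "x \<in> Q" "y \<in> P" for x y using ideal_splittingD(8)[OF assms that(2,1)] .
  show "\<exists>q\<in>Q. x - q \<in> P" if x: "x \<in> V" for x
  proof -
    obtain p where "p \<in> P" "x - p \<in> Q" using ideal_splittingD(13)[OF assms x] by blast
    then show ?thesis by (intro bexI[of _ "x - p"]) auto
  qed
qed

text \<open>Vectors of \<open>P\<close> are orthogonal to \<open>Q\<close>, so one that is also
  orthogonal to \<open>P\<close> is orthogonal to all of \<open>V\<close>.\<close>

lemma ideal_splitting_nondegenerate:
  assumes "ideal_splitting P Q"
  shows "nondegenerate_on g P"
  unfolding nondegenerate_on_def
proof (intro ballI impI)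
  note D = ideal_splittingD[OF assms]
  fix x assume x: "x \<in> P" "\<forall>y\<in>P. B x y = 0"
  show "x = 0"
  proof (rule form_zeroD)
    fix z assume z: "z \<in> V"
    then obtain p where p: "p \<in> P" "z - p \<in> Q" using D(13) by blast
    have "B x p = 0" "B x (z - p) = 0" using x p D(7) by auto
    then show "B x z = 0" using x(1) p z D(5) by simp
  qed (use x D(5) in auto)
qed

lemma ideal_splitting_inter:
  assumes "ideal_splitting P Q" "x \<in> P" "x \<in> Q"
  shows "x = 0"
  using ideal_splitting_nondegenerate[OF assms(1)] ideal_splittingD(8)[OF assms(1)] assms(2,3)
  by (auto simp: nondegenerate_on_def)

text \<open>Each product lies in both strong ideals, which meet trivially.\<close>

lemma ideal_splitting_nabla:
  assumes "ideal_splitting P Q" "x \<in> P" "y \<in> Q"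
  shows "N x y = 0" "N y x = 0"
  using ideal_splitting_inter[OF assms(1)] ideal_splittingD[OF assms(1)] assms(2,3) by metis+

lemma ideal_splitting_nabla_restrict_to:
  assumes "ideal_splitting P Q"
  shows "metric_lie (restrict_to g P)"
    and "x \<in> P \<Longrightarrow> y \<in> P \<Longrightarrow> nabla (restrict_to g P) x y = N x y"
  using metric_lie_restrict_to[of P] nabla_restrict_to[of P] ideal_splittingD[OF assms]
    ideal_splitting_nondegenerate[OF assms] by simp_all

section \<open>An indecomposable factor against a splitting of the whole algebra\<close>

text \<open>Because \<open>Ann_R g = Ann g\<close>, it suffices that every \<open>N x\<close> kills
  \<open>y - p\<close>. Split \<open>x\<close> along \<open>h\<close> and \<open>h'\<close>. For the
  part in \<open>h\<close>, the product lies in \<open>Q\<close> and is orthogonal to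
  \<open>Q\<close> by skewness and the hypothesis on \<open>y\<close>. The part in \<open>h'\<close>
  kills \<open>y\<close>, so its product with \<open>y - p\<close> lies in \<open>P\<close> as well
  as in \<open>Q\<close>.\<close>

lemma diff_component_in_Ann:
  assumes Ann: "Ann_R g = Ann g" and hs: "ideal_splitting h h'" and PQ: "ideal_splitting P Q"
    and y: "y \<in> h" "\<And>x q. x \<in> h \<Longrightarrow> q \<in> Q \<Longrightarrow> B y (N x q) = 0"
    and p: "p \<in> P" "y - p \<in> Q"
  shows "y - p \<in> Ann g"
proof -
  note D = ideal_splittingD[OF hs] and E = ideal_splittingD[OF PQ]
  have "N x (y - p) = 0" if x: "x \<in> V" for x
  proof -
    obtain a where a: "a \<in> h" "x - a \<in> h'" using D(13)[OF x] by blast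
    have aV: "a \<in> V" "x - a \<in> V" "y \<in> V" "p \<in> V" "y - p \<in> V"
      using D(5)[OF a(1)] D(6)[OF a(2)] D(5)[OF y(1)] E(5)[OF p(1)] E(6)[OF p(2)] by blast+
    have aQ: "N a (y - p) \<in> Q" using p aV E(11) by blast
    have "B (N a (y - p)) q = 0" if q: "q \<in> Q" for q
    proof -
      have "N a q \<in> Q" using q aV E(11) by blast
      then have "B p (N a q) = 0" "N a q \<in> V" using p E(7) E(6) by auto
      then show ?thesis using y(2)[OF a(1) q] nabla_skew[of a "y - p" q] aV E(6)[OF q] by simp
    qed
    with aQ have "N a (y - p) = 0"
      using ideal_splitting_nondegenerate[OF ideal_splitting_sym[OF PQ]]
      by (auto simp: nondegenerate_on_def)
    moreover have "N (x - a) (y - p) = 0"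
    proof (rule ideal_splitting_inter[OF PQ])
      have "N (x - a) (y - p) = 0 - N (x - a) p"
        using ideal_splitting_nabla(2)[OF hs y(1) a(2)] nabla_simps(4)[OF aV(3,2,4)] by simp
      then show "N (x - a) (y - p) \<in> P"
        using E(9)[OF aV(2) p(1)] subspace_neg[OF E(1)] by simp
      show "N (x - a) (y - p) \<in> Q" using aV(2) p(2) E(11) by blast
    qed
    ultimately show ?thesis using nabla_simps(3)[of x "y - p" a] x aV by simp
  qed
  then have "y - p \<in> Ann_R g" using D(5)[OF y(1)] E(5)[OF p(1)] by (simp add: Ann_R_def)
  with Ann show ?thesis by simp
qed

text \<open>Modulo the annihilator \<open>y\<close> equals its component \<open>p\<close> in
  \<open>P\<close>, which settles \<open>N x y = N x p\<close>. On the other side \<open>p\<close>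
  kills the component of \<open>x\<close> in \<open>Q\<close>, so with \<open>r\<close> the
  component of \<open>x\<close> in \<open>P\<close> one gets
  \<open>N y x = N p r = N y r\<close>.\<close>

lemma nabla_in_nabla_span_component:
  assumes Ann: "Ann_R g = Ann g" and hs: "ideal_splitting h h'" and PQ: "ideal_splitting P Q"
    and y: "y \<in> h" "\<And>x q. x \<in> h \<Longrightarrow> q \<in> Q \<Longrightarrow> B y (N x q) = 0" and x: "x \<in> h"
  shows "N x y \<in> nabla_span g h P" "N y x \<in> nabla_span g h P"
proof -
  note D = ideal_splittingD[OF hs] and E = ideal_splittingD[OF PQ]
  have xy: "x \<in> V" "y \<in> V" using D(5) x y by auto
  obtain p where p: "p \<in> P" "y - p \<in> Q" using E(13)[OF xy(2)] by blast
  obtain r where r: "r \<in> P" "x - r \<in> Q" using E(13)[OF xy(1)] by blast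
  have V: "p \<in> V" "r \<in> V" "x - r \<in> V" using E(5)[OF p(1)] E(5)[OF r(1)] E(6)[OF r(2)] by blast+
  have ann: "y - p \<in> Ann g" using diff_component_in_Ann[OF Ann hs PQ y p] .
  have "N x y = N x p" "N y x = N p x"  "N y r = N p r"
    using ann xy V subspace_0[OF subspace_Ann] by (auto intro!: nabla_cong_Ann)
  moreover have "N p (x - r) = 0" using ideal_splitting_nabla[OF PQ p(1) r(2)] by simp
  then have "N p x = N p r" using V xy by simp
  ultimately show "N x y \<in> nabla_span g h P" "N y x \<in> nabla_span g h P"
    using nabla_in_nabla_span[OF x p(1)] nabla_in_nabla_span[OF y(1) r(1)] by simp_all
qed

text \<open>If both product spans \<open>?A\<close> and \<open>?C\<close> were non-zero, enlarging
  \<open>?A\<close> to a non-degenerate \<open>H\<close> orthogonal to \<open>?C\<close>, with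
  complement \<open>K\<close> containing \<open>?C\<close>, would decompose
  \<open>h\<close>.\<close>

lemma indecomposable_nabla_eq_zero:
  assumes Ann: "Ann_R g = Ann g" and hs: "ideal_splitting h h'" and PQ: "ideal_splitting P Q"
    and ind: "indecomposable (restrict_to g h)"
  shows "(\<forall>x\<in>h. \<forall>p\<in>P. N x p = 0) \<or> (\<forall>x\<in>h. \<forall>q\<in>Q. N x q = 0)"
proof -
  note D = ideal_splittingD[OF hs] and E = ideal_splittingD[OF PQ]
  interpret R: metric_lie "restrict_to g h" by (rule ideal_splitting_nabla_restrict_to[OF hs])
  note nab = ideal_splitting_nabla_restrict_to(2)[OF hs]
  let ?A = "nabla_span g h P" and ?C = "nabla_span g h Q"
  have A: "?A \<subseteq> h \<inter> P" and C: "?C \<subseteq> h \<inter> Q"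
    using D(1,5,9,10) E(1,2,5,6,9,11)
    by (simp_all only: nabla_span_subset_iff subspace_inter) auto
  have "\<exists>H. subspace H \<and> nondegenerate_on (restrict_to g h) H \<and> H \<subseteq> carrier (restrict_to g h) \<and>
    ?A \<subseteq> H \<and> ?C \<subseteq> perp (restrict_to g h) H"
  proof (rule R.exists_nondegenerate_splitting)
    show "?A \<inter> ?C = {0}"
    proof
      show "?A \<inter> ?C \<subseteq> {0}" using A C ideal_splitting_inter[OF PQ] by blast
      show "{0} \<subseteq> ?A \<inter> ?C" using subspace_0 subspace_nabla_span by blast
    qed
  qed (use A C E(7) in \<open>auto simp: subset_iff\<close>)
  then obtain H where H: "subspace H" "nondegenerate_on g H" "H \<subseteq> h" "?A \<subseteq> H"
    "?C \<subseteq> perp (restrict_to g h) H" by auto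
  define K where "K = perp (restrict_to g h) H"
  have sK: "subspace K" unfolding K_def using H(3) by (intro R.subspace_perp) simp
  have Kh: "K \<subseteq> h" by (auto simp: K_def perp_def)
  have HK: "B x y = 0" "B y x = 0" if "x \<in> H" "y \<in> K" for x y
    using that H(3) R.form_sym[of x y] by (auto simp: K_def perp_def)
  have split: "\<exists>y\<in>H. x - y \<in> K" if "x \<in> h" for x
    unfolding K_def using R.orthogonal_split_nondegenerate[of H x] H that by simp
  have idH: "strong_ideal (restrict_to g h) H"
    unfolding R.strong_ideal_iff carrier_restrict_to
  proof (intro conjI ballI)
    fix x y assume x: "x \<in> h" and y: "y \<in> H"
    \<comment> \<open>\<open>y\<close> is orthogonal to \<open>?C\<close>, so its products with
      \<open>h\<close> on either side fall into \<open>?A\<close>, which is contained in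
      \<open>H\<close>.\<close>
    have "B y (N u q) = 0" if "u \<in> h" "q \<in> Q" for u q
      using HK(1)[OF y] H(5) nabla_in_nabla_span[OF that] by (auto simp: K_def)
    moreover have "y \<in> h" using y H(3) by auto
    ultimately show "nabla (restrict_to g h) x y \<in> H" "nabla (restrict_to g h) y x \<in> H"
      using nabla_in_nabla_span_component[OF Ann hs PQ _ _ x, of y] x H(4) by (auto simp: nab)
  qed (use H in auto)
  have idK: "strong_ideal (restrict_to g h) K"
    unfolding R.strong_ideal_iff carrier_restrict_to
  proof (intro conjI ballI)
    fix x y assume x: "x \<in> h" and y: "y \<in> K"
    \<comment> \<open>The same argument with \<open>P\<close> and \<open>Q\<close> exchanged:
      products of \<open>K\<close> with \<open>h\<close> fall into \<open>?C\<close>, inside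
      \<open>K\<close>.\<close>
    have "B y (N u q) = 0" if "u \<in> h" "q \<in> P" for u q
      using HK(2)[OF _ y] H(4) nabla_in_nabla_span[OF that] by auto
    moreover have "y \<in> h" using y Kh by auto
    ultimately show "nabla (restrict_to g h) x y \<in> K" "nabla (restrict_to g h) y x \<in> K"
      using nabla_in_nabla_span_component[OF Ann hs ideal_splitting_sym[OF PQ] _ _ x, of y] x H(5)
      by (auto simp: nab K_def)
  qed (use sK Kh in auto)
  have ndK: "nondegenerate_on g K"
    unfolding nondegenerate_on_def
  proof (intro ballI impI)
    fix x assume x: "x \<in> K" "\<forall>y\<in>K. B x y = 0"
    have xV: "x \<in> h" using x Kh by auto
    have "B x z = 0" if z: "z \<in> h" for z
    proof -
      obtain y where y: "y \<in> H" "z - y \<in> K" using split[OF z] by blast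
      then have "B x y = 0" "B x (z - y) = 0" using x HK by auto
      then show ?thesis using R.form_simps(4)[of z x y] z y xV H(3) by auto
    qed
    then show "x = 0" using R.form_zeroD[of x] xV by simp
  qed
  have "H \<inter> K = {0}"
  proof
    show "{0} \<subseteq> H \<inter> K" using H(1) sK by (auto simp: subspace_0)
    show "H \<inter> K \<subseteq> {0}" using H(2) HK by (auto simp: nondegenerate_on_def)
  qed
  moreover have "h = {x + y |x y. x \<in> H \<and> y \<in> K}"
  proof
    show "{x + y |x y. x \<in> H \<and> y \<in> K} \<subseteq> h" using H(3) Kh subspace_add[OF D(1)] by blast
    show "h \<subseteq> {x + y |x y. x \<in> H \<and> y \<in> K}"
    proof
      fix x assume "x \<in> h"
      then obtain y where y: "y \<in> H" "x - y \<in> K" using split by blast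
      have "x = y + (x - y)" by simp
      with y show "x \<in> {x + y |x y. x \<in> H \<and> y \<in> K}" by blast
    qed
  qed
  ultimately have "H = {0} \<or> K = {0}"
    using ind idH idK H(2) ndK unfolding decomposable_def by auto
  moreover have "0 \<in> ?A" "0 \<in> ?C" by (simp_all add: subspace_0)
  ultimately have "?A = {0} \<or> ?C = {0}"
    using H(4) H(5)[folded K_def] by (auto dest: subset_singletonD)
  then show ?thesis by (simp add: nabla_span_eq_zero_iff)
qed

text \<open>Left multiplication by \<open>h'\<close> kills \<open>h\<close> in any case, so
  \<open>y\<close> lies in \<open>Ann_R g\<close>, which equals \<open>Ann g\<close>.\<close>

lemma ideal_splitting_in_Ann:
  assumes Ann: "Ann_R g = Ann g" and hs: "ideal_splitting h h'"
    and y: "y \<in> h" and hy: "\<And>u. u \<in> h \<Longrightarrow> N u y = 0"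
  shows "y \<in> Ann g"
proof -
  note D = ideal_splittingD[OF hs]
  have "N v y = 0" if v: "v \<in> V" for v
  proof -
    obtain u where u: "u \<in> h" "v - u \<in> h'" using D(13)[OF v] by blast
    have "N (v - u) y = 0" using ideal_splitting_nabla(2)[OF hs y u(2)] .
    then show ?thesis using hy[OF u(1)] D(5)[OF u(1)] D(5)[OF y] v by simp
  qed
  then show ?thesis using D(5)[OF y] Ann[symmetric] by (auto simp: Ann_R_def)
qed

text \<open>Let \<open>y\<close> be the component of \<open>q\<close> in \<open>h\<close>. By
  hypothesis a product \<open>N u z\<close> inside \<open>h\<close> depends only on the component of
  \<open>z\<close> in \<open>P\<close>, so it lies in \<open>P\<close> and is orthogonal to
  \<open>q\<close>, hence to \<open>y\<close>. Skewness then gives \<open>N u y = 0\<close>, so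
  \<open>y\<close> is in the annihilator, and the remaining component of \<open>q\<close> lies in
  \<open>h'\<close> and kills \<open>h\<close>.\<close>

lemma nabla_zero_swap:
  assumes Ann: "Ann_R g = Ann g" and hs: "ideal_splitting h h'" and PQ: "ideal_splitting P Q"
    and zero: "\<And>x q. x \<in> h \<Longrightarrow> q \<in> Q \<Longrightarrow> N x q = 0" and q: "q \<in> Q" and x: "x \<in> h"
  shows "N q x = 0"
proof -
  note D = ideal_splittingD[OF hs] and E = ideal_splittingD[OF PQ]
  obtain y where y: "y \<in> h" "q - y \<in> h'" using D(13)[OF E(6)[OF q]] by blast
  have V: "q \<in> V" "y \<in> V" "q - y \<in> V" "x \<in> V" using E(6)[OF q] D(5)[OF y(1)] D(6)[OF y(2)] D(5)[OF x] by blast+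
  have hy: "N u y = 0" if u: "u \<in> h" for u
  proof -
    have "B (N u y) z = 0" if z: "z \<in> h" for z
    proof -
      obtain p where p: "p \<in> P" "z - p \<in> Q" using E(13)[OF D(5)[OF z]] by blast
      have uV: "u \<in> V" "z \<in> V" "p \<in> V" using D(5)[OF u] D(5)[OF z] E(5)[OF p(1)] by blast+
      have "N u z = N u p" using zero[OF u p(2)] uV by simp
      then have "B q (N u z) = 0" using E(8)[OF E(9) q] uV p by simp
      moreover have "B (q - y) (N u z) = 0" using D(8)[OF D(9) y(2)] uV z by simp
      ultimately have "B y (N u z) = 0" using V uV by simp
      then show ?thesis using nabla_skew[of u y z] uV V by simp
    qed
    moreover have "N u y \<in> h" using D(9)[OF D(5)[OF u] y(1)] .
    ultimately show ?thesis
      using ideal_splitting_nondegenerate[OF hs] by (auto simp: nondegenerate_on_def)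
  qed
  have "y \<in> Ann g" using ideal_splitting_in_Ann[OF Ann hs y(1) hy] .
  then have "N y x = 0" using V by (auto simp: Ann_def)
  moreover have "N (q - y) x = 0" using ideal_splitting_nabla(2)[OF hs x y(2)] .
  ultimately show ?thesis using V by simp
qed

section \<open>Projections, matched factors and their isometries\<close>

text \<open>Injectivity comes from non-degeneracy on \<open>h\<close>. For surjectivity, the
  functional \<open>B p (f x)\<close> of \<open>x\<close> is represented by some \<open>w\<close> in
  \<open>h\<close>; then \<open>p - f w\<close> is orthogonal to the image of \<open>f\<close> and
  vanishes by \<open>dense\<close>. No dimensions have to be compared.\<close>

lemma isometry_bij_betw:
  assumes h: "subspace h" "h \<subseteq> V" "nondegenerate_on g h" and P: "subspace P" "P \<subseteq> V"
    and into: "\<And>x. x \<in> h \<Longrightarrow> f x \<in> P"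
    and lin: "\<And>x y a b. x \<in> h \<Longrightarrow> y \<in> h \<Longrightarrow> f (a *\<^sub>R x + b *\<^sub>R y) = a *\<^sub>R f x + b *\<^sub>R f y"
    and iso: "\<And>x y. x \<in> h \<Longrightarrow> y \<in> h \<Longrightarrow> B (f x) (f y) = B x y"
    and dense: "\<And>z. z \<in> P \<Longrightarrow> (\<And>x. x \<in> h \<Longrightarrow> B z (f x) = 0) \<Longrightarrow> z = 0"
  shows "bij_betw f h P"
  unfolding bij_betw_def
proof
  have hV: "x \<in> V" if "x \<in> h" for x using that h(2) by auto
  have fV: "f x \<in> V" if "x \<in> h" for x using that P(2) into by auto
  show "inj_on f h"
  proof (rule inj_onI)
    fix x y assume xy: "x \<in> h" "y \<in> h" "f x = f y"
    have "B (x - y) z = 0" if z: "z \<in> h" for z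
      using iso[OF xy(1) z] iso[OF xy(2) z] xy z by (simp add: hV)
    then have "x - y = 0"
      using h(3) subspace_diff[OF h(1) xy(1,2)] by (auto simp: nondegenerate_on_def)
    then show "x = y" by simp
  qed
  show "f ` h = P"
  proof (intro equalityI subsetI)
    fix p assume p: "p \<in> P"
    then have pV: "p \<in> V" using P(2) by auto
    obtain w where w: "w \<in> h" "\<forall>x\<in>h. B w x = B p (f x)"
      using form_represent_on[OF h, of "\<lambda>x. B p (f x)"] pV by (auto simp: lin fV)
    have "p - f w = 0"
    proof (rule dense)
      show "p - f w \<in> P" using p into[OF w(1)] P(1) by (simp add: subspace_diff)
      show "B (p - f w) (f x) = 0" if "x \<in> h" for x
        using w iso[OF w(1) that] that pV by (simp add: fV)
    qed
    then show "p \<in> f ` h" using w(1) by auto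
  qed (use into in auto)
qed

text \<open>Components are chosen pointwise; uniqueness of components makes the choice linear on
  \<open>V\<close>.\<close>

lemma ideal_splitting_projection:
  assumes PQ: "ideal_splitting P Q"
  shows "\<exists>f. (\<forall>x\<in>V. f x \<in> P \<and> x - f x \<in> Q) \<and> (\<forall>x\<in>P. f x = x) \<and>
    (\<forall>x\<in>V. \<forall>y\<in>V. \<forall>a b. f (a *\<^sub>R x + b *\<^sub>R y) = a *\<^sub>R f x + b *\<^sub>R f y)"
proof -
  note E = ideal_splittingD[OF PQ]
  obtain f where f: "\<forall>x\<in>V. f x \<in> P \<and> x - f x \<in> Q"
    using bchoice[of V "\<lambda>x p. p \<in> P \<and> x - p \<in> Q"] E(13) by blast
  have uniq: "p = p'" if "p \<in> P" "x - p \<in> Q" "p' \<in> P" "x - p' \<in> Q" for x p p'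
  proof -
    have "(x - p') - (x - p) \<in> Q" "p - p' \<in> P"
      using that by (simp_all only: subspace_diff E(1,2))
    then have "p - p' = 0" by (intro ideal_splitting_inter[OF PQ]) simp_all
    then show ?thesis by simp
  qed
  have "f x = x" if "x \<in> P" for x
    using f E(5)[OF that] that by (intro uniq[of "f x" x x]) (auto simp: subspace_0 E(2))
  moreover have "f (a *\<^sub>R x + b *\<^sub>R y) = a *\<^sub>R f x + b *\<^sub>R f y" if "x \<in> V" "y \<in> V" for a b x y
  proof (rule uniq[of _ "a *\<^sub>R x + b *\<^sub>R y"])
    have "a *\<^sub>R (x - f x) + b *\<^sub>R (y - f y) \<in> Q"
      using f that by (simp add: subspace_add subspace_scale E(2))
    then show "a *\<^sub>R x + b *\<^sub>R y - (a *\<^sub>R f x + b *\<^sub>R f y) \<in> Q"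
      by (simp add: algebra_simps)
    show "a *\<^sub>R f x + b *\<^sub>R f y \<in> P" using f that by (simp add: subspace_add subspace_scale E(1))
  qed (use f that in auto)
  ultimately show ?thesis using f by blast
qed

text \<open>Pythagoras: the projection to \<open>P\<close> fails to be isometric exactly by the form
  of the components in \<open>Q\<close>.\<close>

lemma form_projection:
  assumes PQ: "ideal_splitting P Q" and xy: "x \<in> V" "y \<in> V"
    and pr: "p \<in> P" "x - p \<in> Q" "r \<in> P" "y - r \<in> Q"
  shows "B p r = B x y - B (x - p) (y - r)"
proof -
  note E = ideal_splittingD[OF PQ]
  have V: "p \<in> V" "r \<in> V" using E(5)[OF pr(1)] E(5)[OF pr(3)] by blast+
  have "B p (y - r) = 0" "B (x - p) r = 0" using E(7)[OF pr(1,4)] E(8)[OF pr(3,2)] by blast+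
  then show ?thesis using V xy by simp
qed

text \<open>When \<open>Ann_R g = Ann g\<close>, these vanishing conditions make \<open>h\<close>
  and \<open>P\<close> equal modulo \<open>Ann g\<close>. The complements are carried along so that
  the relation is symmetric in the two splittings.\<close>

definition matched :: "'a set \<Rightarrow> 'a set \<Rightarrow> 'a set \<Rightarrow> 'a set \<Rightarrow> bool" where
  "matched h h' P Q \<longleftrightarrow> ideal_splitting h h' \<and> ideal_splitting P Q \<and>
     (\<forall>x\<in>h. \<forall>q\<in>Q. N x q = 0) \<and> (\<forall>p\<in>P. \<forall>x\<in>h'. N p x = 0)"

lemma matched_sym: "matched h h' P Q \<Longrightarrow> matched P Q h h'"
  by (simp add: matched_def)

lemma matched_splitting:
  assumes "matched h h' P Q"
  shows "ideal_splitting h h'" "ideal_splitting P Q"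
  using assms by (simp_all add: matched_def)

lemma matched_diff_in_Ann:
  assumes "Ann_R g = Ann g" and M: "matched h h' P Q" and "x \<in> h" "p \<in> P" "x - p \<in> Q"
  shows "x - p \<in> Ann g"
  using assms ideal_splittingD(5)[OF matched_splitting(1)[OF M]]
  by (intro diff_component_in_Ann[of h h' P Q]) (auto simp: matched_def)

lemma matched_component:
  assumes "Ann_R g = Ann g" and M: "matched h h' P Q" and x: "x \<in> h"
  shows "\<exists>p\<in>P. x - p \<in> Ann g"
proof -
  have "x \<in> V" using ideal_splittingD(5)[OF matched_splitting(1)[OF M] x] .
  then obtain p where "p \<in> P" "x - p \<in> Q"
    using ideal_splittingD(13)[OF matched_splitting(2)[OF M]] by blast
  then show ?thesis using matched_diff_in_Ann[OF assms(1) M x] by blast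
qed

lemma matched_nabla_in:
  assumes Ann: "Ann_R g = Ann g" and M: "matched h h' P Q" and xy: "x \<in> h" "y \<in> h"
  shows "N x y \<in> P"
proof -
  note D = ideal_splittingD[OF matched_splitting(1)[OF M]]
  note E = ideal_splittingD[OF matched_splitting(2)[OF M]]
  obtain p r where pr: "p \<in> P" "x - p \<in> Ann g" "r \<in> P" "y - r \<in> Ann g"
    using matched_component[OF Ann M] xy by metis
  have "x \<in> V" "y \<in> V" "p \<in> V" "r \<in> V" using D(5) E(5) xy pr by blast+
  then have "N x y = N p r" using pr by (intro nabla_cong_Ann)
  then show ?thesis using E(9) \<open>p \<in> V\<close> pr by simp
qed

text \<open>\<open>h\<close> and \<open>P\<close> agree modulo the annihilator, and products do not
  see the annihilator.\<close>

lemma matched_nabla_span: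
  assumes Ann: "Ann_R g = Ann g" and M: "matched h h' P Q"
    and A: "A \<in> {h, P}" and C: "C \<in> {h, P}"
  shows "nabla_span g A C = nabla_span g h h"
proof -
  have V: "h \<subseteq> V" "P \<subseteq> V" using ideal_splittingD(3) matched_splitting[OF M] by blast+
  have *: "\<exists>y\<in>C. x - y \<in> Ann g" if "A \<in> {h, P}" "C \<in> {h, P}" "x \<in> A" for A C x
  proof (cases "A = C")
    case True
    with that show ?thesis by (intro bexI[of _ x]) (simp_all add: subspace_0)
  next
    case False
    with that show ?thesis
      using matched_component[OF Ann M, of x] matched_component[OF Ann matched_sym[OF M], of x] by auto
  qed
  have "nabla_span g A C \<subseteq> nabla_span g A' C'"
    if "A \<in> {h, P}" "C \<in> {h, P}" "A' \<in> {h, P}" "C' \<in> {h, P}" for A C A' C'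
    using that V by (intro nabla_span_subset_mod_Ann *[of A A'] *[of C C']) auto
  then show ?thesis using A C by (intro equalityI) auto
qed

text \<open>Isotropy of the right annihilator of \<open>h\<close> makes the correcting operator
  square to zero; isotropy of the right annihilator of \<open>P\<close> is what yields
  surjectivity.\<close>

lemma matched_isometry:
  assumes Ann: "Ann_R g = Ann g" and M: "matched h h' P Q"
    and isoh: "totally_isotropic g (Ann_R (restrict_to g h))"
    and isoP: "totally_isotropic g (Ann_R (restrict_to g P))"
  shows "\<exists>f. strong_isometry (restrict_to g h) (restrict_to g P) f \<and>
    (\<forall>x\<in>nabla_span g h h. f x = x)"
proof -
  note hs = matched_splitting(1)[OF M] and PQ = matched_splitting(2)[OF M]
  note D = ideal_splittingD[OF hs] and E = ideal_splittingD[OF PQ]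
  note hV = D(5) and PV = E(5)
  note ndh = ideal_splitting_nondegenerate[OF hs] and ndP = ideal_splitting_nondegenerate[OF PQ]
  have nd_eq: "x = y" if xy: "x \<in> h" "y \<in> h" and eq: "\<And>z. z \<in> h \<Longrightarrow> B x z = B y z" for x y
  proof -
    have "B (x - y) z = 0" if z: "z \<in> h" for z
      using eq[OF z] hV[OF xy(1)] hV[OF xy(2)] hV[OF z] by simp
    then have "x - y = 0"
      using ndh subspace_diff[OF D(1) xy] unfolding nondegenerate_on_def by blast
    then show ?thesis by simp
  qed
  have isoh': "B x y = 0" if "x \<in> h" "x \<in> Ann g" "y \<in> h" "y \<in> Ann g" for x y
    using isoh that hV ideal_splitting_nabla_restrict_to(2)[OF hs]
    by (auto simp: totally_isotropic_def Ann_R_def Ann_def)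
  have isoP': "B x y = 0" if "x \<in> P" "x \<in> Ann g" "y \<in> P" "y \<in> Ann g" for x y
    using isoP that PV ideal_splitting_nabla_restrict_to(2)[OF PQ]
    by (auto simp: totally_isotropic_def Ann_R_def Ann_def)
  obtain p where p: "\<And>x. x \<in> V \<Longrightarrow> p x \<in> P" "\<And>x. x \<in> V \<Longrightarrow> x - p x \<in> Q"
    "\<And>x. x \<in> P \<Longrightarrow> p x = x"
    "\<And>x y a b. x \<in> V \<Longrightarrow> y \<in> V \<Longrightarrow> p (a *\<^sub>R x + b *\<^sub>R y) = a *\<^sub>R p x + b *\<^sub>R p y"
    using ideal_splitting_projection[OF PQ] by blast
  have pV: "p x \<in> V" if "x \<in> V" for x using p(1) PV that by blast
  define q where "q x = x - p x" for x
  have qA: "q x \<in> Ann g" if "x \<in> h" for x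
    unfolding q_def using that p hV by (intro matched_diff_in_Ann[OF Ann M]) auto
  have qV: "q x \<in> V" if "x \<in> V" for x using that pV by (simp add: q_def)
  have qlin: "q (a *\<^sub>R x + b *\<^sub>R y) = a *\<^sub>R q x + b *\<^sub>R q y" if "x \<in> V" "y \<in> V" for a b x y
    using that by (simp add: q_def p(4) algebra_simps)
  \<comment> \<open>\<open>p\<close> preserves the product but misses the form by \<open>B (q x) (q y)\<close>; half of the operator
    representing this defect corrects it, since its values lie in the isotropic annihilator.\<close>
  have "\<exists>w. w \<in> h \<and> (\<forall>y\<in>h. B w y = B (q x) (q y))" if "x \<in> h" for x
    using form_represent_on[OF D(1,3) ndh, of "\<lambda>y. B (q x) (q y)"] that
    by (auto simp: qlin qV hV)
  then obtain t where t: "\<And>x. x \<in> h \<Longrightarrow> t x \<in> h"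
    "\<And>x y. x \<in> h \<Longrightarrow> y \<in> h \<Longrightarrow> B (t x) y = B (q x) (q y)"
    by metis
  have lin_h: "a *\<^sub>R x + b *\<^sub>R y \<in> h" if "x \<in> h" "y \<in> h" for a b x y
    using that D(1) by (simp add: subspace_add subspace_scale)
  have tlin: "t (a *\<^sub>R x + b *\<^sub>R y) = a *\<^sub>R t x + b *\<^sub>R t y" if "x \<in> h" "y \<in> h" for a b x y
    by (rule nd_eq) (use that t hV qV lin_h in \<open>simp_all add: qlin\<close>)
  \<comment> \<open>Products of elements of \<open>h\<close> also lie in \<open>P\<close>, where
    \<open>p\<close> is the identity. Hence \<open>q\<close> and then \<open>t\<close> vanish on
    them, so the corrected map will fix \<open>nabla_span g h h\<close>.\<close>
  have qN: "q (N x y) = 0" if "x \<in> h" "y \<in> h" for x y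
    using matched_nabla_in[OF Ann M that] by (simp add: q_def p(3))
  have Nh: "N x y \<in> h" if "x \<in> h" "y \<in> h" for x y using D(9)[OF hV[OF that(1)] that(2)] .
  have tN: "t (N x y) = 0" if "x \<in> h" "y \<in> h" for x y
    by (rule nd_eq) (use that t hV qV qN Nh subspace_0[OF D(1)] in simp_all)
  \<comment> \<open>By skewness, pairing \<open>N u (t x)\<close> with \<open>z\<close> gives minus
    the form of \<open>q x\<close> and \<open>q (N u z)\<close>, and the latter is zero.\<close>
  have tA: "t x \<in> Ann g" if x: "x \<in> h" for x
  proof (rule ideal_splitting_in_Ann[OF Ann hs])
    show "t x \<in> h" using t x by blast
    fix u assume u: "u \<in> h"
    show "N u (t x) = 0"
    proof (rule nd_eq)
      fix z assume z: "z \<in> h"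
      have "B (N u (t x)) z = - B (t x) (N u z)"
        using u x z t hV by (intro nabla_skew) auto
      also have "\<dots> = 0" using t(2)[OF x Nh[OF u z]] qN[OF u z] qV hV x by simp
      finally show "B (N u (t x)) z = B 0 z" using z hV by simp
    qed (use u x t Nh subspace_0[OF D(1)] in auto)
  qed
  \<comment> \<open>\<open>t\<close> is self-adjoint with values in the isotropic space of
    annihilator vectors of \<open>h\<close>, so it vanishes on that space; in particular
    \<open>t (t x) = 0\<close>.\<close>
  have tt: "t z = 0" if "z \<in> h" "z \<in> Ann g" for z
  proof (rule nd_eq)
    fix y assume y: "y \<in> h"
    have "B (t z) y = B (t y) z" using t(2) y that form_sym[of "q z" "q y"] qV hV by simp
    also have "\<dots> = 0" using isoh' t(1) tA y that by blast
    finally show "B (t z) y = B 0 y" using y hV by simp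
  qed (use that t subspace_0[OF D(1)] in auto)
  define c where "c x = x + (1/2) *\<^sub>R t x" for x
  define f where "f x = p (c x)" for x
  have ch: "c x \<in> h" if "x \<in> h" for x using that t D(1) by (simp add: c_def subspace_add subspace_scale)
  have clin: "c (a *\<^sub>R x + b *\<^sub>R y) = a *\<^sub>R c x + b *\<^sub>R c y" if "x \<in> h" "y \<in> h" for a b x y
    using that by (simp add: c_def tlin algebra_simps)
  have flin: "f (a *\<^sub>R x + b *\<^sub>R y) = a *\<^sub>R f x + b *\<^sub>R f y" if "x \<in> h" "y \<in> h" for a b x y
    using that by (simp add: f_def clin p(4) ch hV)
  have fP: "f x \<in> P" if "x \<in> h" for x using that by (simp add: f_def p(1) ch hV)
  have tc: "t (c x) = t x" if "x \<in> h" for x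
    using tlin[of x "t x" 1 "1/2"] that t tt tA by (simp add: c_def)
  have fA: "x - f x \<in> Ann g" if "x \<in> h" for x
  proof -
    have "q (c x) - (1/2) *\<^sub>R t x \<in> Ann g"
      using that by (intro subspace_diff subspace_scale qA tA ch) simp_all
    then show ?thesis by (simp add: q_def f_def c_def)
  qed
  \<comment> \<open>The defect of \<open>p\<close> at \<open>c x\<close>, \<open>c y\<close> is
    \<open>B (t x) y\<close>. It cancels against the two cross terms of
    \<open>B (c x) (c y)\<close>, each half of \<open>B (t x) y\<close>, while the term quadratic in
    \<open>t\<close> vanishes by isotropy.\<close>
  have fiso: "B (f x) (f y) = B x y" if x: "x \<in> h" and y: "y \<in> h" for x y
  proof -
    have V: "x \<in> V" "y \<in> V" "t x \<in> V" "t y \<in> V" "c x \<in> V" "c y \<in> V"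
      using x y t ch hV by auto
    have "B (f x) (f y) = B (c x) (c y) - B (q (c x)) (q (c y))"
      unfolding f_def q_def using V p by (intro form_projection[OF PQ]) auto
    also have "B (q (c x)) (q (c y)) = B (t x) (c y)"
      using t(2)[OF ch[OF x] ch[OF y]] tc[OF x] by simp
    also have "B (t x) (c y) = B (t x) y"
      using V isoh'[of "t x" "t y"] x y t tA by (simp add: c_def)
    also have "B (c x) (c y) = B x y + (1/2) * B (t x) y + (1/2) * B x (t y)"
      using V isoh'[of "t x" "t y"] x y t tA by (simp add: c_def)
    also have "B x (t y) = B (t x) y"
      using form_sym[of x "t y"] form_sym[of "q x" "q y"] t(2) x y V qV by simp
    finally show ?thesis by simp
  qed
  have fN: "f (N x y) = N x y" if "x \<in> h" "y \<in> h" for x y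
    using that tN matched_nabla_in[OF Ann M that] by (simp add: f_def c_def p(3))
  have Nf: "N (f x) (f y) = N x y" if "x \<in> h" "y \<in> h" for x y
    using that fA fP hV PV by (intro nabla_cong_Ann[symmetric]) auto
  \<comment> \<open>Products in \<open>P\<close> are products in \<open>h\<close>, hence fixed by
    \<open>f\<close> and orthogonal to \<open>z\<close>; skewness puts \<open>z\<close> into the
    annihilator. Any \<open>r\<close> in \<open>P\<close> differs from some \<open>f a\<close> by an
    annihilator vector of \<open>P\<close>, and isotropy makes \<open>z\<close> orthogonal to that
    difference too.\<close>
  have dense: "z = 0" if z: "z \<in> P" and orth: "\<And>x. x \<in> h \<Longrightarrow> B z (f x) = 0" for z
  proof -
    have zA: "z \<in> Ann g"
    proof (rule ideal_splitting_in_Ann[OF Ann PQ z])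
      fix u assume u: "u \<in> P"
      have "B (N u z) w = 0" if w: "w \<in> P" for w
      proof -
        obtain a b where ab: "a \<in> h" "u - a \<in> Ann g" "b \<in> h" "w - b \<in> Ann g"
          using matched_component[OF Ann matched_sym[OF M]] u w by metis
        have "N u w = N a b" using ab u w hV PV by (intro nabla_cong_Ann) auto
        then have "B z (N u w) = 0" using orth[OF Nh[OF ab(1,3)]] fN ab by simp
        then show ?thesis using nabla_skew[of u z w] u w z PV by simp
      qed
      moreover have "N u z \<in> P" using E(9) PV u z by blast
      ultimately show "N u z = 0" using ndP by (auto simp: nondegenerate_on_def)
    qed
    have "B z r = 0" if r: "r \<in> P" for r
    proof -
      obtain a where a: "a \<in> h" "r - a \<in> Ann g"
        using matched_component[OF Ann matched_sym[OF M] r] by blast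
      have "(r - a) + (a - f a) \<in> Ann g" using a fA by (intro subspace_add) auto
      moreover have "r - f a \<in> P" using r fP[OF a(1)] E(1) by (simp add: subspace_diff)
      ultimately have "B z (r - f a) = 0" using isoP'[OF z zA] by simp
      then show ?thesis using orth[OF a(1)] PV z r fP[OF a(1)] by simp
    qed
    then show ?thesis using ndP z by (auto simp: nondegenerate_on_def)
  qed
  have "bij_betw f h P"
    using isometry_bij_betw[OF D(1,3) ndh E(1,3) fP flin fiso dense] by blast
  then have "strong_isometry (restrict_to g h) (restrict_to g P) f"
    using flin fiso
    by (simp add: strong_isometry_def ideal_splitting_nabla_restrict_to(2)[OF hs]
        ideal_splitting_nabla_restrict_to(2)[OF PQ] fP fN Nf)
  moreover have "nabla_span g h h \<subseteq> {x \<in> h. f x = x}"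
  proof (rule nabla_span_subset)
    show "subspace {x \<in> h. f x = x}"
    proof (rule subspaceI)
      show "0 \<in> {x \<in> h. f x = x}" using flin[of 0 0 0 0] subspace_0[OF D(1)] by simp
      show "x + y \<in> {x \<in> h. f x = x}" if "x \<in> {x \<in> h. f x = x}" "y \<in> {x \<in> h. f x = x}" for x y
        using flin[of x y 1 1] that subspace_add[OF D(1)] by simp
      show "a *\<^sub>R x \<in> {x \<in> h. f x = x}" if "x \<in> {x \<in> h. f x = x}" for a x
        using flin[of x x a 0] that subspace_scale[OF D(1)] by simp
    qed
  qed (use fN Nh in auto)
  ultimately show ?thesis by blast
qed

section \<open>The annihilator summands\<close>

text \<open>Maximality makes the vectors of \<open>A\<close> orthogonal to \<open>H\<close>
  isotropic, and polarization makes them mutually orthogonal. As \<open>A\<close> is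
  \<open>H\<close> plus such vectors, they form the radical of \<open>A\<close>.\<close>

lemma maximal_nondegenerate_radical:
  assumes A: "subspace A" "A \<subseteq> V" and H: "maximal_nondegenerate_subspace g A H"
    and w: "w \<in> A" "\<And>y. y \<in> H \<Longrightarrow> B w y = 0" and v: "v \<in> A"
  shows "B w v = 0"
proof -
  have AV: "x \<in> V" if "x \<in> A" for x using that A(2) by auto
  have H': "subspace H" "H \<subseteq> A" "nondegenerate_on g H"
    and max: "\<And>k. subspace k \<Longrightarrow> k \<subseteq> A \<Longrightarrow> nondegenerate_on g k \<Longrightarrow> H \<subseteq> k \<Longrightarrow> k = H"
    using H by (auto simp: maximal_nondegenerate_subspace_def)
  have HV: "x \<in> V" if "x \<in> H" for x using that H'(2) AV by auto
  have isotropic: "B u u = 0" if u: "u \<in> A" "\<And>y. y \<in> H \<Longrightarrow> B u y = 0" for u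
  proof (rule ccontr)
    assume nz: "B u u \<noteq> 0"
    \<comment> \<open>Adjoining a non-isotropic \<open>u\<close> orthogonal to \<open>H\<close>
      would give a larger non-degenerate subspace of \<open>A\<close>.\<close>
    define k where "k = {y + a *\<^sub>R u | y a. y \<in> H}"
    have mem: "y + a *\<^sub>R u \<in> k" if "y \<in> H" for y a using that by (auto simp: k_def)
    have uV: "u \<in> V" using AV u by blast
    have uk: "u \<in> k" using mem[OF subspace_0[OF H'(1)], of 1] by simp
    have Hk: "H \<subseteq> k" using mem[of _ 0] by auto
    have sk: "subspace k"
    proof (rule subspaceI)
      show "0 \<in> k" using mem[OF subspace_0[OF H'(1)], of 0] by simp
      fix x y assume "x \<in> k" "y \<in> k"
      then obtain x' a y' b where xy: "x = x' + a *\<^sub>R u" "y = y' + b *\<^sub>R u" "x' \<in> H" "y' \<in> H"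
        by (auto simp: k_def)
      have "x + y = (x' + y') + (a + b) *\<^sub>R u" using xy by (simp add: algebra_simps)
      then show "x + y \<in> k" using mem[OF subspace_add[OF H'(1) xy(3,4)]] by simp
    next
      fix c x assume "x \<in> k"
      then obtain x' a where x: "x = x' + a *\<^sub>R u" "x' \<in> H" by (auto simp: k_def)
      then have "c *\<^sub>R x = c *\<^sub>R x' + (c * a) *\<^sub>R u" by (simp add: algebra_simps)
      then show "c *\<^sub>R x \<in> k" using mem[OF subspace_scale[OF H'(1) x(2)]] by simp
    qed
    have kA: "k \<subseteq> A" using u H'(2) A(1) by (auto simp: k_def intro!: subspace_add subspace_scale)
    have ndk: "nondegenerate_on g k"
      unfolding nondegenerate_on_def
    proof (intro ballI impI)
      fix x assume x: "x \<in> k" "\<forall>y\<in>k. B x y = 0"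
      then obtain x' a where x': "x = x' + a *\<^sub>R u" "x' \<in> H" by (auto simp: k_def)
      have "B x' y = 0" if y: "y \<in> H" for y
      proof -
        have "B x y = 0" using x y Hk by blast
        then show ?thesis using x' u(2)[OF y] HV y uV by simp
      qed
      then have "x' = 0" using H'(3) x'(2) by (auto simp: nondegenerate_on_def)
      moreover have "B x u = 0" using x uk by blast
      ultimately show "x = 0" using x' uV nz by simp
    qed
    have "u \<in> H" using max[OF sk kA ndk Hk] uk by simp
    then show False using u(2) nz by blast
  qed
  have polar: "B x y = 0"
    if "x \<in> A" "y \<in> A" "\<And>z. z \<in> H \<Longrightarrow> B x z = 0" "\<And>z. z \<in> H \<Longrightarrow> B y z = 0" for x y
  proof -
    have V: "x \<in> V" "y \<in> V" using that AV by auto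
    have "B (x + y) (x + y) = 0"
      using that V HV by (intro isotropic subspace_add[OF A(1)]) auto
    then show ?thesis using V isotropic[of x] isotropic[of y] that form_sym[of x y] by simp
  qed
  obtain y where y: "y \<in> H" "v - y \<in> perp g H"
    using orthogonal_split_nondegenerate[OF H'(1) _ H'(3) AV[OF v]] HV by blast
  have "v - y \<in> A" using v y(1) H'(2) A(1) by (auto intro: subspace_diff)
  moreover have "B (v - y) z = 0" if "z \<in> H" for z using y(2) that by (simp only: perp_def mem_Collect_eq)
  ultimately have "B w (v - y) = 0" using polar[of w "v - y"] w by blast
  then show ?thesis using w(2)[OF y(1)] AV[OF w(1)] AV[OF v] HV[OF y(1)] by simp
qed

lemma subspace_in_Ann_strong_ideal:
  assumes "subspace h" "h \<subseteq> Ann g"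
  shows "strong_ideal g h"
  unfolding strong_ideal_iff using assms subspace_0[OF assms(1)] by (auto simp: Ann_def subset_iff)

lemma nabla_restrict_to_Ann:
  assumes h: "subspace h" "h \<subseteq> Ann g" "nondegenerate_on g h" and "x \<in> h" "y \<in> h"
  shows "nabla (restrict_to g h) x y = 0"
proof -
  have "N x y = 0" if "x \<in> h" "y \<in> h" for x y using that h(2) by (auto simp: Ann_def)
  moreover have "h \<subseteq> V" using h(2) by (auto simp: Ann_def)
  ultimately show ?thesis using nabla_restrict_to[of h x y] assms by (simp add: subspace_0)
qed

text \<open>\<open>H\<close> and \<open>P\<close> are both complements of the radical of
  \<open>Ann g\<close>. The projection to \<open>P\<close> along \<open>Q\<close> moves a vector of
  \<open>H\<close> by an annihilator vector orthogonal to \<open>P\<close>, that is, by a radical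
  vector, so it is isometric; products on both sides are zero.\<close>

lemma maximal_nondegenerate_isometry:
  assumes PQ: "ideal_splitting P Q"
    and H: "maximal_nondegenerate_subspace g (Ann g) H"
    and P: "maximal_nondegenerate_subspace g (Ann g) P"
  shows "\<exists>f. strong_isometry (restrict_to g H) (restrict_to g P) f"
proof -
  note E = ideal_splittingD[OF PQ]
  have AV: "Ann g \<subseteq> V" by (auto simp: Ann_def)
  have H': "subspace H" "H \<subseteq> Ann g" "nondegenerate_on g H"
    and P': "subspace P" "P \<subseteq> Ann g" "nondegenerate_on g P"
    using H P by (auto simp: maximal_nondegenerate_subspace_def)
  have HV: "x \<in> V" if "x \<in> H" for x using that H'(2) AV by auto
  obtain f where f: "\<And>x. x \<in> V \<Longrightarrow> f x \<in> P" "\<And>x. x \<in> V \<Longrightarrow> x - f x \<in> Q"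
    "\<And>x y a b. x \<in> V \<Longrightarrow> y \<in> V \<Longrightarrow> f (a *\<^sub>R x + b *\<^sub>R y) = a *\<^sub>R f x + b *\<^sub>R f y"
    using ideal_splitting_projection[OF PQ] by blast
  have fiso: "B (f x) (f y) = B x y" if xy: "x \<in> H" "y \<in> H" for x y
  proof -
    have V: "x \<in> V" "y \<in> V" using HV xy by auto
    have A: "x - f x \<in> Ann g" "y - f y \<in> Ann g"
      using f(1)[OF V(1)] f(1)[OF V(2)] xy H'(2) P'(2) by (auto intro!: subspace_diff)
    have "B (x - f x) (y - f y) = 0"
      using maximal_nondegenerate_radical[OF subspace_Ann AV P A(1) _ A(2)] f(2)[OF V(1)] E(8) by blast
    then show ?thesis
      using form_projection[OF PQ V f(1)[OF V(1)] f(2)[OF V(1)] f(1)[OF V(2)] f(2)[OF V(2)]] by simp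
  qed
  \<comment> \<open>Such a \<open>z\<close> is orthogonal to \<open>H\<close> as well, because
    \<open>x - f x\<close> lies in \<open>Q\<close>; so it is a radical vector of
    \<open>Ann g\<close> inside the non-degenerate \<open>P\<close>.\<close>
  have dense: "z = 0" if z: "z \<in> P" and orth: "\<And>x. x \<in> H \<Longrightarrow> B z (f x) = 0" for z
  proof -
    have zA: "z \<in> Ann g" using z P'(2) by auto
    have "B z x = 0" if x: "x \<in> H" for x
      using orth[OF x] E(7)[OF z f(2)[OF HV[OF x]]] E(5)[OF z] HV[OF x] E(5)[OF f(1)[OF HV[OF x]]]
      by simp
    then have "B z v = 0" if "v \<in> P" for v
      using maximal_nondegenerate_radical[OF subspace_Ann AV H zA] that P'(2) by blast
    then show ?thesis using P'(3) z by (auto simp: nondegenerate_on_def)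
  qed
  have "H \<subseteq> V" using HV by blast
  then have "bij_betw f H P"
    using f(1) f(3) fiso HV dense by (intro isometry_bij_betw[OF H'(1) _ H'(3) P'(1) E(3)]) auto
  moreover have "f 0 = 0" using f(3)[of 0 0 0 0] by simp
  ultimately have "strong_isometry (restrict_to g H) (restrict_to g P) f"
    using HV f(1) f(3) fiso
    by (simp add: strong_isometry_def nabla_restrict_to_Ann[OF H'] nabla_restrict_to_Ann[OF P'])
  then show ?thesis by blast
qed

section \<open>Orthogonal direct sums of ideals and of isometries\<close>

text \<open>Reduces a decomposition with many summands to two-part splittings: the remaining
  summands together span the complementary ideal.\<close>

lemma orthogonal_direct_sum_splitting:
  assumes I: "finite I" and S: "orthogonal_direct_sum g I h"
    and ideal: "\<And>i. i \<in> I \<Longrightarrow> strong_ideal g (h i)" and i: "i \<in> I"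
  shows "ideal_splitting (h i) (span (\<Union>j\<in>I - {i}. h j))"
proof -
  let ?Q = "span (\<Union>j\<in>I - {i}. h j)"
  have hV: "x \<in> V" if "x \<in> h j" "j \<in> I" for x j
    using ideal[OF that(2)] that(1) by (auto simp: strong_ideal_iff)
  have base: "x \<in> ?Q" if "x \<in> h j" "j \<in> I" "j \<noteq> i" for x j
    using that by (intro span_base) auto
  have QV: "?Q \<subseteq> V" using hV by (intro span_minimal) auto
  have "?Q \<subseteq> {y \<in> V. \<forall>v\<in>V. N v y \<in> ?Q \<and> N y v \<in> ?Q}"
  proof (rule span_minimal)
    show "subspace {y \<in> V. \<forall>v\<in>V. N v y \<in> ?Q \<and> N y v \<in> ?Q}"
      by (rule subspaceI) (auto intro: span_add span_scale span_zero)
    show "(\<Union>j\<in>I - {i}. h j) \<subseteq> {y \<in> V. \<forall>v\<in>V. N v y \<in> ?Q \<and> N y v \<in> ?Q}"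
    proof
      fix y assume "y \<in> (\<Union>j\<in>I - {i}. h j)"
      then obtain j where j: "j \<in> I" "j \<noteq> i" "y \<in> h j" by auto
      have "N v y \<in> h j \<and> N y v \<in> h j" if "v \<in> V" for v
        using ideal[OF j(1)] j(3) that by (auto simp: strong_ideal_iff)
      then show "y \<in> {y \<in> V. \<forall>v\<in>V. N v y \<in> ?Q \<and> N y v \<in> ?Q}"
        using base j hV by blast
    qed
  qed
  then have "strong_ideal g ?Q" unfolding strong_ideal_iff using QV by auto
  moreover have "B x y = 0" if x: "x \<in> h i" and y: "y \<in> ?Q" for x y
  proof -
    have "?Q \<subseteq> {y \<in> V. B x y = 0}"
    proof (rule span_minimal)
      show "subspace {y \<in> V. B x y = 0}" using hV[OF x i] by (intro subspaceI) auto
      show "(\<Union>j\<in>I - {i}. h j) \<subseteq> {y \<in> V. B x y = 0}"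
        using S i x hV by (auto simp: orthogonal_direct_sum_def)
    qed
    then show ?thesis using y by blast
  qed
  moreover have "\<exists>p\<in>h i. x - p \<in> ?Q" if "x \<in> V" for x
  proof -
    obtain c where c: "\<forall>j\<in>I. c j \<in> h j" "x = (\<Sum>j\<in>I. c j)"
      using S \<open>x \<in> V\<close> by (auto simp: orthogonal_direct_sum_def)
    have "x - c i = (\<Sum>j\<in>I - {i}. c j)" using c(2) sum.remove[OF I i, of c] by simp
    also have "\<dots> \<in> ?Q" using c(1) base by (intro span_sum) auto
    finally show ?thesis using c(1) i by blast
  qed
  ultimately show ?thesis using ideal[OF i] by (simp add: ideal_splitting_def)
qed

text \<open>Distinct summands are orthogonal and have zero products, so form and product are
  computed summand by summand, where each \<open>f i\<close> preserves them. Injectivity of the sum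
  then follows from non-degeneracy.\<close>

lemma direct_sum_strong_isometry:
  assumes I: "finite I"
    and h: "orthogonal_direct_sum g I h" "\<And>i. i \<in> I \<Longrightarrow> strong_ideal g (h i)"
    and k: "orthogonal_direct_sum g I k" "\<And>i. i \<in> I \<Longrightarrow> strong_ideal g (k i)"
    and f: "\<And>i. i \<in> I \<Longrightarrow> strong_isometry (restrict_to g (h i)) (restrict_to g (k i)) (f i)"
  shows "\<exists>F. is_direct_sum_map I h f F \<and> strong_isometry g g F"
proof -
  have split: "ideal_splitting (l i) (span (\<Union>j\<in>I - {i}. l j))"
    if "l \<in> {h, k}" "i \<in> I" for l i
    using that h k orthogonal_direct_sum_splitting[OF I] by auto
  have V: "x \<in> V" if "l \<in> {h, k}" "i \<in> I" "x \<in> l i" for l i x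
    using ideal_splittingD(5)[OF split[OF that(1,2)] that(3)] .
  have other: "y \<in> span (\<Union>j\<in>I - {i}. l j)" if "y \<in> l j" "j \<in> I" "i \<noteq> j" for l i j y
    using that by (intro span_base) auto
  \<comment> \<open>Stated for both families at once, since arguments of \<open>F\<close> are
    decomposed along \<open>h\<close> and values along \<open>k\<close>.\<close>
  have form: "B (\<Sum>i\<in>I. x i) (\<Sum>i\<in>I. y i) = (\<Sum>i\<in>I. B (x i) (y i))"
    and nabla: "N (\<Sum>i\<in>I. x i) (\<Sum>i\<in>I. y i) = (\<Sum>i\<in>I. N (x i) (y i))"
    if l: "l \<in> {h, k}" and x: "\<forall>i\<in>I. x i \<in> l i" and y: "\<forall>i\<in>I. y i \<in> l i" for l x y
  proof -
    have xV: "x i \<in> V" and yV: "y i \<in> V" if "i \<in> I" for i using V[OF l that] x y that by auto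
    have "B (x i) (\<Sum>j\<in>I. y j) = B (x i) (y i)" "N (x i) (\<Sum>j\<in>I. y j) = N (x i) (y i)" if i: "i \<in> I" for i
    proof -
      have "B (x i) (y j) = 0" "N (x i) (y j) = 0" if "j \<in> I" "j \<noteq> i" for j
        using ideal_splittingD(7)[OF split[OF l i]] ideal_splitting_nabla(1)[OF split[OF l i]]
          other[of "y j" l j i] that x y i by blast+
      then have "(\<Sum>j\<in>I - {i}. B (x i) (y j)) = 0" "(\<Sum>j\<in>I - {i}. N (x i) (y j)) = 0"
        by (auto intro!: sum.neutral)
      then have "(\<Sum>j\<in>I. B (x i) (y j)) = B (x i) (y i)" "(\<Sum>j\<in>I. N (x i) (y j)) = N (x i) (y i)"
        using sum.remove[OF I i, of "\<lambda>j. B (x i) (y j)"] sum.remove[OF I i, of "\<lambda>j. N (x i) (y j)"]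
        by simp_all
      then show "B (x i) (\<Sum>j\<in>I. y j) = B (x i) (y i)" "N (x i) (\<Sum>j\<in>I. y j) = N (x i) (y i)"
        using i by (simp_all add: form_sum_right[OF I] nabla_sum_right[OF I] xV yV)
    qed
    moreover have "(\<Sum>j\<in>I. y j) \<in> V" using yV by (intro carrier_sum)
    ultimately show "B (\<Sum>i\<in>I. x i) (\<Sum>i\<in>I. y i) = (\<Sum>i\<in>I. B (x i) (y i))"
      "N (\<Sum>i\<in>I. x i) (\<Sum>i\<in>I. y i) = (\<Sum>i\<in>I. N (x i) (y i))"
      by (simp_all add: form_sum_left[OF I] nabla_sum_left[OF I] xV)
  qed
  have bij: "bij_betw (f i) (h i) (k i)" if "i \<in> I" for i
    using f[OF that] by (simp add: strong_isometry_def)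
  have flin: "f i (a *\<^sub>R x + b *\<^sub>R y) = a *\<^sub>R f i x + b *\<^sub>R f i y"
    if "i \<in> I" "x \<in> h i" "y \<in> h i" for i x y a b
    using f[OF that(1)] that by (simp add: strong_isometry_def)
  have fiso: "B (f i x) (f i y) = B x y" if "i \<in> I" "x \<in> h i" "y \<in> h i" for i x y
    using f[OF that(1)] that by (simp add: strong_isometry_def)
  have fk: "f i x \<in> k i" if "i \<in> I" "x \<in> h i" for i x
    using bij[OF that(1)] that by (auto simp: bij_betw_def)
  have fN: "f i (N x y) = N (f i x) (f i y)" if "i \<in> I" "x \<in> h i" "y \<in> h i" for i x y
    using f[OF that(1)] that fk[OF that(1)] ideal_splitting_nabla_restrict_to(2)[OF split[of h i]]
      ideal_splitting_nabla_restrict_to(2)[OF split[of k i]] by (simp add: strong_isometry_def)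
  have sub: "subspace (h i)" if "i \<in> I" for i using ideal_splittingD(1)[OF split[of h i]] that by simp
  obtain c where c: "\<And>x i. x \<in> V \<Longrightarrow> i \<in> I \<Longrightarrow> c x i \<in> h i" "\<And>x. x \<in> V \<Longrightarrow> (\<Sum>i\<in>I. c x i) = x"
  proof -
    have "\<forall>x\<in>V. \<exists>c. (\<forall>i\<in>I. c i \<in> h i) \<and> (\<Sum>i\<in>I. c i) = x"
      using h(1) by (auto simp: orthogonal_direct_sum_def)
    from bchoice[OF this] show ?thesis using that by blast
  qed
  define F where "F x = (\<Sum>i\<in>I. f i (c x i))" for x
  \<comment> \<open>\<open>F\<close> is defined by chosen components; directness of the sum shows
    that any components give the same value.\<close>
  have F: "F (\<Sum>i\<in>I. x i) = (\<Sum>i\<in>I. f i (x i))" if x: "\<forall>i\<in>I. x i \<in> h i" for x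
  proof -
    have xV: "(\<Sum>i\<in>I. x i) \<in> V" using x V[of h] by (intro carrier_sum) auto
    let ?c = "c (\<Sum>i\<in>I. x i)"
    have diff: "\<forall>i\<in>I. ?c i - x i \<in> h i" using c(1)[OF xV] x sub by (auto intro: subspace_diff)
    have sum0: "(\<Sum>i\<in>I. ?c i - x i) = 0" using c(2)[OF xV] by (simp add: sum_subtractf)
    have "\<forall>d. (\<forall>i\<in>I. d i \<in> h i) \<and> (\<Sum>i\<in>I. d i) = 0 \<longrightarrow> (\<forall>i\<in>I. d i = 0)"
      using h(1) by (simp add: orthogonal_direct_sum_def)
    then have "\<forall>i\<in>I. ?c i - x i = 0"
      using diff sum0 by (elim allE[of _ "\<lambda>i. ?c i - x i"]) blast
    then show ?thesis by (simp add: F_def)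
  qed
  have Fk: "\<forall>i\<in>I. f i (c x i) \<in> k i" if "x \<in> V" for x using c(1)[OF that] fk by blast
  have FV: "F x \<in> V" if "x \<in> V" for x
    unfolding F_def using Fk[OF that] V[of k] by (intro carrier_sum) auto
  have Flin: "F (a *\<^sub>R x + b *\<^sub>R y) = a *\<^sub>R F x + b *\<^sub>R F y" if "x \<in> V" "y \<in> V" for a b x y
  proof -
    have "a *\<^sub>R x + b *\<^sub>R y = (\<Sum>i\<in>I. a *\<^sub>R c x i + b *\<^sub>R c y i)"
      using c(2)[OF that(1)] c(2)[OF that(2)] by (simp add: sum.distrib flip: scaleR_sum_right)
    also have "F \<dots> = (\<Sum>i\<in>I. f i (a *\<^sub>R c x i + b *\<^sub>R c y i))"
      using c(1) that sub by (intro F) (auto intro!: subspace_add subspace_scale)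
    also have "\<dots> = (\<Sum>i\<in>I. a *\<^sub>R f i (c x i) + b *\<^sub>R f i (c y i))"
      using c(1) that by (intro sum.cong flin) auto
    finally show ?thesis by (simp add: F_def sum.distrib scaleR_sum_right)
  qed
  have Fiso: "B (F x) (F y) = B x y" if "x \<in> V" "y \<in> V" for x y
  proof -
    have "B (F x) (F y) = (\<Sum>i\<in>I. B (f i (c x i)) (f i (c y i)))"
      unfolding F_def using Fk that by (intro form[of k]) auto
    also have "\<dots> = (\<Sum>i\<in>I. B (c x i) (c y i))" using c(1) that by (intro sum.cong fiso) auto
    also have "\<dots> = B (\<Sum>i\<in>I. c x i) (\<Sum>i\<in>I. c y i)"
      using c(1) that by (intro form[of h, symmetric]) auto
    finally show ?thesis using c(2) that by simp
  qed
  have FN: "F (N x y) = N (F x) (F y)" if "x \<in> V" "y \<in> V" for x y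
  proof -
    have N: "N (c x i) (c y i) \<in> h i" if i: "i \<in> I" for i
      using h(2)[OF i] V[of h i] c(1) i \<open>x \<in> V\<close> \<open>y \<in> V\<close> by (auto simp: strong_ideal_iff)
    have "N x y = N (\<Sum>i\<in>I. c x i) (\<Sum>i\<in>I. c y i)" using c(2) that by simp
    also have "\<dots> = (\<Sum>i\<in>I. N (c x i) (c y i))" using c(1) that by (intro nabla[of h]) auto
    also have "F \<dots> = (\<Sum>i\<in>I. f i (N (c x i) (c y i)))" using N by (intro F) auto
    also have "\<dots> = (\<Sum>i\<in>I. N (f i (c x i)) (f i (c y i)))" using c(1) that by (intro sum.cong fN) auto
    also have "\<dots> = N (F x) (F y)"
      unfolding F_def using Fk that by (intro nabla[of k, symmetric]) auto
    finally show ?thesis .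
  qed
  have "bij_betw F V V"
    unfolding bij_betw_def
  proof
    show "inj_on F V"
    proof (rule inj_onI)
      fix x y assume xy: "x \<in> V" "y \<in> V" "F x = F y"
      then have "B x z = B y z" if "z \<in> V" for z using Fiso[OF _ that] by metis
      then show "x = y" using xy by (intro form_eqI)
    qed
    show "F ` V = V"
    proof (intro equalityI subsetI)
      fix y assume "y \<in> V"
      then obtain d where d: "\<forall>i\<in>I. d i \<in> k i" "y = (\<Sum>i\<in>I. d i)"
        using k(1) by (auto simp: orthogonal_direct_sum_def)
      have "\<exists>x. x \<in> h i \<and> f i x = d i" if "i \<in> I" for i
      proof -
        have "d i \<in> f i ` h i" using bij_betw_imp_surj_on[OF bij[OF that]] d(1) that by simp
        then show ?thesis by auto
      qed
      then have "\<forall>i\<in>I. \<exists>x. x \<in> h i \<and> f i x = d i" by blast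
      from bchoice[OF this] obtain x where x: "\<forall>i\<in>I. x i \<in> h i \<and> f i (x i) = d i" by blast
      then have "F (\<Sum>i\<in>I. x i) = y" using F[of x] d(2) by simp
      moreover have "(\<Sum>i\<in>I. x i) \<in> V" using x V[of h] by (intro carrier_sum) auto
      ultimately show "y \<in> F ` V" by blast
    qed (use FV in auto)
  qed
  then have "strong_isometry g g F" using Flin Fiso FN by (simp add: strong_isometry_def)
  moreover have "is_direct_sum_map I h f F" using F by (simp add: is_direct_sum_map_def)
  ultimately show ?thesis by blast
qed

section \<open>Matching the factors of two decompositions\<close>

lemma annihilator_decomposition_splitting:
  assumes G: "annihilator_decomposition g n G" and i: "i \<in> {0..n}"
  shows "ideal_splitting (G i) (span (\<Union>j\<in>{0..n} - {i}. G j))"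
    and "strong_ideal g (G i)"
proof -
  have ideal: "strong_ideal g (G j)" if "j \<in> {0..n}" for j
  proof (cases "j = 0")
    case True
    then show ?thesis
      using G by (auto simp: annihilator_decomposition_def maximal_nondegenerate_subspace_def
          intro: subspace_in_Ann_strong_ideal)
  next
    case False
    then show ?thesis using G that by (simp add: annihilator_decomposition_def)
  qed
  show "strong_ideal g (G i)" by (rule ideal[OF i])
  show "ideal_splitting (G i) (span (\<Union>j\<in>{0..n} - {i}. G j))"
    using G ideal i by (intro orthogonal_direct_sum_splitting) (auto simp: annihilator_decomposition_def)
qed

text \<open>Otherwise the factor would be its own right annihilator, hence both totally isotropic
  and non-degenerate, hence zero.\<close>

lemma factor_nabla_nonzero:
  assumes G: "annihilator_decomposition g n G" and i: "i \<in> {1..n}"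
  shows "\<exists>x\<in>G i. \<exists>y\<in>G i. N x y \<noteq> 0"
proof (rule ccontr)
  assume zero: "\<not> ?thesis"
  have i0: "i \<in> {0..n}" using i by simp
  have "G i \<subseteq> Ann_R (restrict_to g (G i))"
    using zero ideal_splitting_nabla_restrict_to(2)[OF annihilator_decomposition_splitting(1)[OF G i0]]
    by (auto simp: Ann_R_def)
  then have "x = 0" if "x \<in> G i" for x
    using G i that
    by (auto simp: annihilator_decomposition_def totally_isotropic_def nondegenerate_on_def subset_iff)
  moreover have "0 \<in> G i"
    using annihilator_decomposition_splitting(2)[OF G i0] by (simp add: strong_ideal_iff subspace_0)
  ultimately have "G i = {0}" by auto
  then show False using G i by (simp add: annihilator_decomposition_def)
qed

text \<open>Take a non-zero product in \<open>G i\<close> and expand its right argument along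
  \<open>G'\<close>. The component in \<open>G' 0\<close> is in the annihilator, so some component
  with positive index contributes.\<close>

lemma factor_meets_factor:
  assumes G: "annihilator_decomposition g n G" and G': "annihilator_decomposition g m G'"
    and i: "i \<in> {1..n}"
  shows "\<exists>j\<in>{1..m}. \<exists>x\<in>G i. \<exists>p\<in>G' j. N x p \<noteq> 0"
proof -
  obtain x y where xy: "x \<in> G i" "y \<in> G i" "N x y \<noteq> 0"
    using factor_nabla_nonzero[OF G i] by blast
  have "i \<in> {0..n}" using i by simp
  note hs = annihilator_decomposition_splitting(1)[OF G this]
  have V: "x \<in> V" "y \<in> V" using ideal_splittingD(5)[OF hs] xy by blast+
  then obtain c where c: "\<forall>j\<in>{0..m}. c j \<in> G' j" "y = (\<Sum>j\<in>{0..m}. c j)"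
    using G' by (auto simp: annihilator_decomposition_def orthogonal_direct_sum_def)
  have cV: "c j \<in> V" if "j \<in> {0..m}" for j
    using annihilator_decomposition_splitting(2)[OF G' that] c(1) that by (auto simp: strong_ideal_iff)
  have "N x y = (\<Sum>j\<in>{0..m}. N x (c j))"
    unfolding c(2) using cV V(1) by (intro nabla_sum_right) auto
  then have "\<not> (\<forall>j\<in>{0..m}. N x (c j) = 0)"
    using xy(3) sum.neutral[of "{0..m}" "\<lambda>j. N x (c j)"] by argo
  then obtain j where j: "j \<in> {0..m}" "N x (c j) \<noteq> 0" by blast
  have "G' 0 \<subseteq> Ann g"
    using G' by (simp add: annihilator_decomposition_def maximal_nondegenerate_subspace_def)
  moreover have "c 0 \<in> G' 0" using c(1) by simp
  ultimately have "N x (c 0) = 0" using V(1) by (auto simp: Ann_def)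
  then have "j \<noteq> 0" using j(2) by metis
  then show ?thesis using j c(1) xy(1) by (intro bexI[of _ j] bexI[of _ x] bexI[of _ "c j"]) auto
qed

text \<open>Indecomposability of \<open>G i\<close> gives the first vanishing condition. The swap
  lemma then shows that only the component in \<open>G' j\<close> of a left factor from
  \<open>G i\<close> acts on \<open>G i\<close>, so \<open>G' j\<close> has a non-zero product with
  \<open>G i\<close>, and indecomposability of \<open>G' j\<close> gives the second
  condition.\<close>

lemma factors_matched:
  assumes Ann: "Ann_R g = Ann g"
    and G: "annihilator_decomposition g n G" and G': "annihilator_decomposition g m G'"
    and i: "i \<in> {1..n}" and j: "j \<in> {1..m}"
    and meet: "\<exists>x\<in>G i. \<exists>p\<in>G' j. N x p \<noteq> 0"
  shows "matched (G i) (span (\<Union>k\<in>{0..n} - {i}. G k)) (G' j) (span (\<Union>k\<in>{0..m} - {j}. G' k))"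
    (is "matched _ ?S _ ?S'")
proof -
  have "i \<in> {0..n}" "j \<in> {0..m}" using i j by auto
  note hs = annihilator_decomposition_splitting(1)[OF G this(1)]
    and PQ = annihilator_decomposition_splitting(1)[OF G' this(2)]
  note D = ideal_splittingD[OF hs] and E = ideal_splittingD[OF PQ]
  have "indecomposable (restrict_to g (G i))" "indecomposable (restrict_to g (G' j))"
    using G G' i j by (auto simp: annihilator_decomposition_def)
  note ind = this
  have zero: "N x q = 0" if "x \<in> G i" "q \<in> ?S'" for x q
    using indecomposable_nabla_eq_zero[OF Ann hs PQ ind(1)] meet that by blast
  obtain x y where xy: "x \<in> G i" "y \<in> G i" "N x y \<noteq> 0"
    using factor_nabla_nonzero[OF G i] by blast
  have xV: "x \<in> V" "y \<in> V" using D(5) xy by blast+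
  obtain p where p: "p \<in> G' j" "x - p \<in> ?S'" using E(13)[OF xV(1)] by blast
  have "N (x - p) y = 0" using nabla_zero_swap[OF Ann hs PQ zero p(2) xy(2)] .
  then have "N p y \<noteq> 0" using xy(3) xV E(5)[OF p(1)] by auto
  then have "\<forall>p\<in>G' j. \<forall>x\<in>?S. N p x = 0"
    using indecomposable_nabla_eq_zero[OF Ann PQ hs ind(2)] p(1) xy(2) by blast
  then show ?thesis using hs PQ zero by (simp add: matched_def)
qed

lemma matched_meets:
  assumes Ann: "Ann_R g = Ann g" and M: "matched h h' P Q" and "\<exists>x\<in>h. \<exists>y\<in>h. N x y \<noteq> 0"
  shows "\<exists>p\<in>P. \<exists>x\<in>h. N p x \<noteq> 0"
proof -
  have "nabla_span g h h \<noteq> {0}" using assms(3) by (auto simp: nabla_span_eq_zero_iff)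
  then have "nabla_span g P h \<noteq> {0}" using matched_nabla_span[OF Ann M, of P h] by simp
  then show ?thesis by (auto simp: nabla_span_eq_zero_iff)
qed

text \<open>Each factor picks a factor it meets. The choice is injective: if \<open>i\<close> and
  \<open>k\<close> shared a partner, that partner would kill \<open>G k\<close> by its matching with
  \<open>G i\<close>, yet it has a non-zero product with \<open>G k\<close>.\<close>

lemma exists_factor_matching:
  assumes Ann: "Ann_R g = Ann g"
    and G: "annihilator_decomposition g n G" and G': "annihilator_decomposition g m G'"
  shows "\<exists>s. inj_on s {1..n} \<and> s ` {1..n} \<subseteq> {1..m} \<and>
    (\<forall>i\<in>{1..n}. matched (G i) (span (\<Union>k\<in>{0..n} - {i}. G k))
      (G' (s i)) (span (\<Union>k\<in>{0..m} - {s i}. G' k)))"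
proof -
  have "\<forall>i\<in>{1..n}. \<exists>j. j \<in> {1..m} \<and> (\<exists>x\<in>G i. \<exists>p\<in>G' j. N x p \<noteq> 0)"
    using factor_meets_factor[OF G G'] by blast
  from bchoice[OF this] obtain s where
    s: "\<forall>i\<in>{1..n}. s i \<in> {1..m} \<and> (\<exists>x\<in>G i. \<exists>p\<in>G' (s i). N x p \<noteq> 0)" by blast
  have M: "matched (G i) (span (\<Union>k\<in>{0..n} - {i}. G k)) (G' (s i)) (span (\<Union>k\<in>{0..m} - {s i}. G' k))"
    if "i \<in> {1..n}" for i
    using factors_matched[OF Ann G G' that] s that by blast
  have "inj_on s {1..n}"
  proof (rule inj_onI, rule ccontr)
    fix i k assume ik: "i \<in> {1..n}" "k \<in> {1..n}" "s i = s k" "i \<noteq> k"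
    obtain p x where px: "p \<in> G' (s k)" "x \<in> G k" "N p x \<noteq> 0"
      using matched_meets[OF Ann M[OF ik(2)] factor_nabla_nonzero[OF G ik(2)]] by blast
    have "x \<in> span (\<Union>k\<in>{0..n} - {i}. G k)" using ik px by (intro span_base) auto
    then have "N p x = 0" using M[OF ik(1)] px(1) ik(3) by (simp add: matched_def)
    then show False using px(3) by simp
  qed
  then show ?thesis using s M by blast
qed

end

section \<open>Reordering the factors and assembling the isometry\<close>

lemma orthogonal_direct_sum_permute:
  assumes s: "s permutes I" and h: "orthogonal_direct_sum g I h"
  shows "orthogonal_direct_sum g I (h \<circ> s)"
proof -
  note im = permutes_in_image[OF s] and inv = permutes_inverses[OF s] and s' = permutes_inv[OF s]
  have sum: "(\<Sum>i\<in>I. x (s i)) = (\<Sum>i\<in>I. x i)" for x :: "_ \<Rightarrow> 'b"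
    using sum.permute[OF s, of x] by (simp add: o_def)
  have sum': "(\<Sum>i\<in>I. x (inv s i)) = (\<Sum>i\<in>I. x i)" for x :: "_ \<Rightarrow> 'b"
    using sum.permute[OF s', of x] by (simp add: o_def)
  have "{\<Sum>i\<in>I. x i | x. \<forall>i\<in>I. x i \<in> h i} = {\<Sum>i\<in>I. x i | x. \<forall>i\<in>I. x i \<in> h (s i)}"
  proof (intro equalityI subsetI)
    fix y assume "y \<in> {\<Sum>i\<in>I. x i | x. \<forall>i\<in>I. x i \<in> h i}"
    then obtain x where "y = (\<Sum>i\<in>I. x i)" "\<forall>i\<in>I. x i \<in> h i" by blast
    then show "y \<in> {\<Sum>i\<in>I. x i | x. \<forall>i\<in>I. x i \<in> h (s i)}"
      using sum[of x] im by (auto intro!: exI[of _ "\<lambda>i. x (s i)"])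
  next
    fix y assume "y \<in> {\<Sum>i\<in>I. x i | x. \<forall>i\<in>I. x i \<in> h (s i)}"
    then obtain x where x: "y = (\<Sum>i\<in>I. x i)" "\<forall>i\<in>I. x i \<in> h (s i)" by blast
    have "x (inv s i) \<in> h i" if "i \<in> I" for i
      using x(2) that inv(1)[of i] permutes_in_image[OF s', of i] by force
    then show "y \<in> {\<Sum>i\<in>I. x i | x. \<forall>i\<in>I. x i \<in> h i}"
      using x(1) sum'[of x] by (auto intro!: exI[of _ "\<lambda>i. x (inv s i)"])
  qed
  moreover have "\<forall>i\<in>I. x i = 0" if x: "\<forall>i\<in>I. x i \<in> h (s i)" "(\<Sum>i\<in>I. x i) = 0" for x
  proof -
    have mem: "\<forall>i\<in>I. x (inv s i) \<in> h i"
      using x(1) inv(1) permutes_in_image[OF s'] by metis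
    have "\<forall>y. (\<forall>i\<in>I. y i \<in> h i) \<and> (\<Sum>i\<in>I. y i) = 0 \<longrightarrow> (\<forall>i\<in>I. y i = 0)"
      using h by (simp add: orthogonal_direct_sum_def)
    then have "(\<forall>i\<in>I. x (inv s i) \<in> h i) \<and> (\<Sum>i\<in>I. x (inv s i)) = 0 \<longrightarrow> (\<forall>i\<in>I. x (inv s i) = 0)"
      by (rule spec)
    then have "\<forall>i\<in>I. x (inv s i) = 0" using mem sum'[of x] x(2) by argo
    then have "x (inv s (s i)) = 0" if "i \<in> I" for i using that im by blast
    then show ?thesis by (simp add: inv(2))
  qed
  moreover have "form g X Y = 0"
    if ij: "i \<in> I" "j \<in> I" "i \<noteq> j" and XY: "X \<in> h (s i)" "Y \<in> h (s j)" for i j X Y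
  proof -
    have "s i \<noteq> s j" using ij(3) permutes_inj[OF s] by (auto dest: injD)
    moreover have "s i \<in> I" "s j \<in> I" using im ij by auto
    moreover have "\<forall>i\<in>I. \<forall>j\<in>I. i \<noteq> j \<longrightarrow> (\<forall>X\<in>h i. \<forall>Y\<in>h j. form g X Y = 0)"
      using h by (simp add: orthogonal_direct_sum_def)
    ultimately show ?thesis using XY by blast
  qed
  ultimately show ?thesis
    using h im by (simp add: orthogonal_direct_sum_def)
qed

theorem theorem3p9:
  fixes g :: "('a::real_vector) metric_lie"
    and G G' :: "nat \<Rightarrow> 'a set"
    and n m :: nat
  assumes "metric_lie_algebra g"
    and "Ann_R g = Ann g"
    and "annihilator_decomposition g n G"
    and "annihilator_decomposition g m G'"
  shows "n = m \<and>
    (\<exists>\<sigma>. \<sigma> permutes {1..n} \<and>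
      (\<forall>i\<in>{1..n}.
         nabla_span g (G i) (G i) = nabla_span g (G i) (G' (\<sigma> i)) \<and>
         nabla_span g (G i) (G' (\<sigma> i)) = nabla_span g (G' (\<sigma> i)) (G i) \<and>
         nabla_span g (G' (\<sigma> i)) (G i) = nabla_span g (G' (\<sigma> i)) (G' (\<sigma> i))) \<and>
      (\<forall>i\<in>{1..n}. \<forall>j\<in>{1..n}. i \<noteq> j \<longrightarrow>
         nabla_span g (G i) (G' (\<sigma> j)) = {0} \<and>
         nabla_span g (G' (\<sigma> j)) (G i) = {0}) \<and>
      (\<exists>\<phi> F.
         strong_isometry (restrict_to g (G 0)) (restrict_to g (G' 0)) (\<phi> 0) \<and>
         (\<forall>i\<in>{1..n}.
            strong_isometry (restrict_to g (G i)) (restrict_to g (G' (\<sigma> i))) (\<phi> i) \<and>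
            (\<forall>X\<in>nabla_span g (G i) (G i). \<phi> i X = X)) \<and>
         is_direct_sum_map {0..n} G \<phi> F \<and>
         strong_isometry g g F))"
proof -
  interpret metric_lie g using assms(1) by unfold_locales
  note Ann = assms(2) and G = assms(3) and G' = assms(4)
  obtain s where s: "inj_on s {1..n}" "s ` {1..n} \<subseteq> {1..m}"
    and sM: "\<forall>i\<in>{1..n}. matched (G i) (span (\<Union>k\<in>{0..n} - {i}. G k))
      (G' (s i)) (span (\<Union>k\<in>{0..m} - {s i}. G' k))"
    using exists_factor_matching[OF Ann G G'] by blast
  \<comment> \<open>The matching in the opposite direction gives the second injection for the count
    \<open>n = m\<close>.\<close>
  obtain s' where s': "inj_on s' {1..m}" "s' ` {1..m} \<subseteq> {1..n}"
    using exists_factor_matching[OF Ann G' G] by blast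
  have nm: "n = m"
    using card_inj_on_le[OF s] card_inj_on_le[OF s'] by simp
  \<comment> \<open>Extended by the identity, \<open>\<sigma>\<close> is a permutation that fixes
    index 0, so the annihilator summand stays in place when \<open>G'\<close> is reordered.\<close>
  define \<sigma> where "\<sigma> i = (if i \<in> {1..n} then s i else i)" for i
  have "bij_betw s {1..n} {1..n}"
    using s nm by (simp add: bij_betw_def endo_inj_surj)
  then have "bij_betw \<sigma> {1..n} {1..n}" by (rule bij_betw_cong[THEN iffD1, rotated]) (simp add: \<sigma>_def)
  then have perm: "\<sigma> permutes {1..n}" by (rule bij_imp_permutes) (auto simp: \<sigma>_def)
  then have perm0: "\<sigma> permutes {0..n}" by (rule permutes_subset) auto
  have \<sigma>0: "\<sigma> 0 = 0" by (simp add: \<sigma>_def)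
  have M: "matched (G i) (span (\<Union>k\<in>{0..n} - {i}. G k)) (G' (\<sigma> i)) (span (\<Union>k\<in>{0..n} - {\<sigma> i}. G' k))"
    if "i \<in> {1..n}" for i
    using sM that nm by (simp add: \<sigma>_def)
  have spans: "nabla_span g A C = nabla_span g (G i) (G i)"
    if "i \<in> {1..n}" "A \<in> {G i, G' (\<sigma> i)}" "C \<in> {G i, G' (\<sigma> i)}" for i A C
    using matched_nabla_span[OF Ann M[OF that(1)] that(2,3)] .
  \<comment> \<open>The first product vanishes by the matching of index \<open>i\<close>, the second
    by the matching of index \<open>j\<close>.\<close>
  have zero: "N x p = 0" "N p x = 0"
    if ij: "i \<in> {1..n}" "j \<in> {1..n}" "i \<noteq> j" and xp: "x \<in> G i" "p \<in> G' (\<sigma> j)" for i j x p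
  proof -
    have "\<sigma> j \<in> {0..n}" "\<sigma> j \<noteq> \<sigma> i"
      using permutes_in_image[OF perm0, of j] permutes_inj[OF perm] ij by (auto dest: injD)
    then have "p \<in> span (\<Union>k\<in>{0..n} - {\<sigma> i}. G' k)" using xp(2) by (intro span_base) auto
    then show "N x p = 0" using M[OF ij(1)] xp(1) by (simp add: matched_def)
    have "x \<in> span (\<Union>k\<in>{0..n} - {j}. G k)" using xp(1) ij by (intro span_base) auto
    then show "N p x = 0" using M[OF ij(2)] xp(2) by (simp add: matched_def)
  qed
  have iso: "\<exists>f. strong_isometry (restrict_to g (G i)) (restrict_to g (G' (\<sigma> i))) f \<and>
      (\<forall>x\<in>nabla_span g (G i) (G i). f x = x)" if i: "i \<in> {1..n}" for i
  proof (rule matched_isometry[OF Ann M[OF i]])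
    show "totally_isotropic g (Ann_R (restrict_to g (G i)))"
      using G i by (simp add: annihilator_decomposition_def)
    have "\<sigma> i \<in> {1..m}" using permutes_in_image[OF perm, of i] i nm by simp
    then show "totally_isotropic g (Ann_R (restrict_to g (G' (\<sigma> i))))"
      using G' by (simp add: annihilator_decomposition_def)
  qed
  obtain \<psi> where \<psi>: "\<forall>i\<in>{1..n}. strong_isometry (restrict_to g (G i)) (restrict_to g (G' (\<sigma> i))) (\<psi> i) \<and>
      (\<forall>x\<in>nabla_span g (G i) (G i). \<psi> i x = x)"
    using bchoice[of "{1..n}" "\<lambda>i f. strong_isometry (restrict_to g (G i)) (restrict_to g (G' (\<sigma> i))) f \<and>
      (\<forall>x\<in>nabla_span g (G i) (G i). f x = x)"] iso by blast
  obtain f0 where f0: "strong_isometry (restrict_to g (G 0)) (restrict_to g (G' 0)) f0"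
  proof -
    have "maximal_nondegenerate_subspace g (Ann g) (G 0)" "maximal_nondegenerate_subspace g (Ann g) (G' 0)"
      using G G' by (simp_all add: annihilator_decomposition_def)
    then show ?thesis
      using maximal_nondegenerate_isometry[OF annihilator_decomposition_splitting(1)[OF G', of 0]] that
      by auto
  qed
  define \<phi> where "\<phi> = \<psi>(0 := f0)"
  have \<phi>: "strong_isometry (restrict_to g (G i)) (restrict_to g ((G' \<circ> \<sigma>) i)) (\<phi> i)"
    if "i \<in> {0..n}" for i
    using that f0 \<psi> by (cases "i = 0") (auto simp: \<phi>_def \<sigma>0)
  have "orthogonal_direct_sum g {0..n} (G' \<circ> \<sigma>)"
    using G' nm by (intro orthogonal_direct_sum_permute[OF perm0]) (simp add: annihilator_decomposition_def)
  moreover have "strong_ideal g ((G' \<circ> \<sigma>) i)" if "i \<in> {0..n}" for i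
    using annihilator_decomposition_splitting(2)[OF G'] permutes_in_image[OF perm0] that nm by simp
  moreover have "orthogonal_direct_sum g {0..n} G"
    using G by (simp add: annihilator_decomposition_def)
  ultimately obtain F where F: "is_direct_sum_map {0..n} G \<phi> F" "strong_isometry g g F"
    using direct_sum_strong_isometry[of "{0..n}" G "G' \<circ> \<sigma>" \<phi>] \<phi>
      annihilator_decomposition_splitting(2)[OF G] by blast
  have iso0: "strong_isometry (restrict_to g (G 0)) (restrict_to g (G' 0)) (\<phi> 0)"
    using f0 by (simp add: \<phi>_def)
  have isos: "\<forall>i\<in>{1..n}. strong_isometry (restrict_to g (G i)) (restrict_to g (G' (\<sigma> i))) (\<phi> i) \<and>
      (\<forall>X\<in>nabla_span g (G i) (G i). \<phi> i X = X)"
    using \<psi> by (simp add: \<phi>_def)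
  have eqs: "\<forall>i\<in>{1..n}.
         nabla_span g (G i) (G i) = nabla_span g (G i) (G' (\<sigma> i)) \<and>
         nabla_span g (G i) (G' (\<sigma> i)) = nabla_span g (G' (\<sigma> i)) (G i) \<and>
         nabla_span g (G' (\<sigma> i)) (G i) = nabla_span g (G' (\<sigma> i)) (G' (\<sigma> i))"
  proof
    fix i assume i: "i \<in> {1..n}"
    show "nabla_span g (G i) (G i) = nabla_span g (G i) (G' (\<sigma> i)) \<and>
         nabla_span g (G i) (G' (\<sigma> i)) = nabla_span g (G' (\<sigma> i)) (G i) \<and>
         nabla_span g (G' (\<sigma> i)) (G i) = nabla_span g (G' (\<sigma> i)) (G' (\<sigma> i))"
      using spans[OF i, of "G i" "G' (\<sigma> i)"] spans[OF i, of "G' (\<sigma> i)" "G i"]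
        spans[OF i, of "G' (\<sigma> i)" "G' (\<sigma> i)"] by simp
  qed
  have zeros: "\<forall>i\<in>{1..n}. \<forall>j\<in>{1..n}. i \<noteq> j \<longrightarrow>
         nabla_span g (G i) (G' (\<sigma> j)) = {0} \<and> nabla_span g (G' (\<sigma> j)) (G i) = {0}"
    using zero by (simp add: nabla_span_eq_zero_iff)
  show ?thesis
    by (intro conjI exI[of _ \<sigma>] exI[of _ \<phi>] exI[of _ F]) (fact nm perm eqs zeros iso0 isos F)+
qed

end
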